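(* For $n=1,2,3$ the composihedron $\mathcal{CK}(n)$ is combinatorially equivalent to the associahedron $\mathcal{K}(n+1)$. In dimension three the two sequences first diverge: the associahedron $\mathcal{K}(5)$ has $9$ facets and $14$ vertices, while the composihedron $\mathcal{CK}(4)$ has $10$ facets and $15$ vertices; in particular $\mathcal{CK}(4)$ is not combinatorially equivalent to $\mathcal{K}(5)$.
   Context: **Painted trees.** All trees are planar rooted trees with a root edge and leaf edges; the root and leaves are exterior vertices, all other vertices are called nodes. In a painted tree each edge is painted or unpainted; the root edge is painted and all leaf edges are unpainted. Each node must be of one of these types: (1) trivalent (one edge below, two above), all edges unpainted; (2) trivalent, all edges painted; (3) bivalent, lower edge painted and the single upper edge unpainted; (4) one lower and at least two upper edges, all unpainted; (5) one lower and at least two upper edges, all painted; (6) painted lower edge and one or more upper edges, all unpainted. A painted binary tree has only nodes of types (1), (2), (3). The $n$-leaved painted corolla is the painted tree with $n$ leaves and only one node, of type (6). A painted tree $t$ refines $t'$ if $t'$ results from $t$ by collapsing some (possibly none) of the internal edges of $t$. A minimal refinement is a proper refinement with no painted tree strictly in between. Leaves are numbered $0,1,\dots,n-1$ from left to right. **Domain equivalence.** Two painted trees are domain equivalent if both refine a common painted tree, where the collapses involved in both refinements are only of unpainted internal edges whose two end nodes are of type (1) or (4). **Associahedra.** $\mathcal{K}(m)$ is the $(m-2)$-dimensional associahedron for $m\ge2$ ($\mathcal{K}(1)=\mathcal{K}(2)$ is a point); its faces correspond to $m$-leaved planar rooted (unpainted) trees all of whose nodes have at least two upper edges, ordered by refinement.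 **Composihedra.** The CW-complexes $\mathcal{CK}(n)$ (of dimension $n-1$) are defined recursively. $\mathcal{CK}(1)$ is a point, associated to the one-leaved painted tree (one type (3) node). Suppose $\mathcal{CK}(k)$ is defined for $k<n$, with the $k$-leaved painted corolla associated to $\mathcal{CK}(k)$. Then $\mathcal{CK}(n)$ is the cone on an $(n-2)$-dimensional CW-complex $\partial\mathcal{CK}(n)$, and is associated to the $n$-leaved painted corolla. The top-dimensional cells of $\partial\mathcal{CK}(n)$ (the facets of $\mathcal{CK}(n)$) are in bijection with the following painted trees with $n$ leaves: - upper trees $u(m;r_1,\dots,r_m)$, for $2\le m\le n$, $r_i\ge1$, $r_1+\dots+r_m=n$: the lowest node is painted with $m$ painted upper edges, and the $i$-th of these (from the left) ends in a type (6) node with $r_i$ leaves (type (3) if $r_i=1$). The corresponding upper facet is a copy of $\mathcal{K}(m)\times\mathcal{CK}(r_1)\times\dots\times\mathcal{CK}(r_m)$; - minimal lower trees $l(k,2)$, for $1\le k\le n-1$: the lowest node is of type (6) with $n-1$ upper edges, all of which are leaf edges except the $k$-th from the left, which ends in a type (1) node carrying the leaves $k-1$ and $k$. The corresponding lower facet $\mathcal{CK}_k(n-1,2)$ is a copy of $\mathcal{CK}(n-1)\times\mathcal{K}(2)\cong\mathcal{CK}(n-1)$. Each sub-facet (codimension-one face) of one of these facets is a product of faces of smaller associahedra and composihedra, and inductively comes with associated trees for its factors, from which one gets an $n$-leaved painted tree that is a minimal refinement of the tree of the facet: for a sub-facet of an upper facet, paint entirely the $m$-leaved tree associated to the face of $\mathcal{K}(m)$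 and graft to its leaves, in order, the painted trees associated to the faces of $\mathcal{CK}(r_1),\dots,\mathcal{CK}(r_m)$; for a sub-facet of $\mathcal{CK}_k(n-1,2)$, with associated $(n-1)$-leaved upper or minimal lower tree $T$, graft an unpainted 2-leaved tree with one node to the $k$-th leaf of $T$. The complex $\partial\mathcal{CK}(n)$ is the union of all these facets, where the intersection of two facets consists of the sub-facets of each whose associated trees are domain equivalent (these being identified). In particular the 0-cells (vertices) of $\mathcal{CK}(n)$ are labelled bijectively by the domain equivalence classes of $n$-leaved painted binary trees. Combinatorially equivalent means having isomorphic face posets. *)

theory Defs
  imports Main
begin

section \<open>Planar trees and associahedra\<close>

datatype utree = Leaf | UNode "utree list"

fun leaves :: "utree \<Rightarrow> nat" where
  "leaves Leaf = 1"
| "leaves (UNode ts) = sum_list (map leaves ts)"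

fun nodes :: "utree \<Rightarrow> nat" where
  "nodes Leaf = 0"
| "nodes (UNode ts) = Suc (sum_list (map nodes ts))"

fun unpainted :: "utree \<Rightarrow> bool" where
  "unpainted Leaf = True"
| "unpainted (UNode ts) = (2 \<le> length ts \<and> (\<forall>t \<in> set ts. unpainted t))"

definition corolla :: "nat \<Rightarrow> utree" where
  "corolla m = UNode (replicate m Leaf)"

text \<open>Collapsing one internal edge; \<^term>\<open>refines s t\<close> collapses any number of them.\<close>

inductive collapse1 :: "utree \<Rightarrow> utree \<Rightarrow> bool" where
  "collapse1 (UNode (xs @ UNode ys # zs)) (UNode (xs @ ys @ zs))"
| "collapse1 s t \<Longrightarrow> collapse1 (UNode (xs @ s # zs)) (UNode (xs @ t # zs))"

definition refines :: "utree \<Rightarrow> utree \<Rightarrow> bool" where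
  "refines = collapse1\<^sup>*\<^sup>*"

definition assoc_faces :: "nat \<Rightarrow> utree set" where
  "assoc_faces m = {t. unpainted t \<and> leaves t = m}"

text \<open>Face posets are relations whose field is the set of faces; \<open>(x, y)\<close> means that
  \<open>x\<close> is contained in \<open>y\<close>.\<close>

definition associahedron :: "nat \<Rightarrow> utree rel" where
  "associahedron m = {(s, t). s \<in> assoc_faces m \<and> t \<in> assoc_faces m \<and> refines s t}"

text \<open>A face of \<open>K(m)\<close>, \<open>m \<ge> 2\<close>, has codimension one less than the number of nodes of its
  tree; truncated subtraction makes \<open>K(1)\<close> a point as well.\<close>

definition assoc_dim :: "utree \<Rightarrow> nat" where
  "assoc_dim t = leaves t - 1 - nodes t"

definition assoc_faces_dim :: "nat \<Rightarrow> nat \<Rightarrow> utree set" where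
  "assoc_faces_dim m d = {t \<in> assoc_faces m. assoc_dim t = d}"


section \<open>Painted trees\<close>

text \<open>The root edge being painted, an edge is painted iff the node at its upper end is a
  \<open>PNode\<close> or an \<open>MNode\<close>.  Hence a \<open>UNode\<close> is a node of type (1) or (4), a \<open>PNode\<close> one of
  type (2) or (5), and an \<open>MNode\<close> (painted lower edge, all upper edges unpainted) one of
  type (3) or (6).\<close>

datatype ptree = PNode "ptree list" | MNode "utree list"

fun painted :: "ptree \<Rightarrow> bool" where
  "painted (PNode ts) = (2 \<le> length ts \<and> (\<forall>t \<in> set ts. painted t))"
| "painted (MNode ts) = (1 \<le> length ts \<and> (\<forall>t \<in> set ts. unpainted t))"

fun pleaves :: "ptree \<Rightarrow> nat" where
  "pleaves (PNode ts) = sum_list (map pleaves ts)"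
| "pleaves (MNode ts) = sum_list (map leaves ts)"

definition painted_corolla :: "nat \<Rightarrow> ptree" where
  "painted_corolla n = MNode (replicate n Leaf)"

text \<open>Collapsing one unpainted internal edge both of whose ends are of type (1) or (4).\<close>

inductive dcollapse1 :: "ptree \<Rightarrow> ptree \<Rightarrow> bool" where
  "collapse1 s t \<Longrightarrow> dcollapse1 (MNode (xs @ s # zs)) (MNode (xs @ t # zs))"
| "dcollapse1 s t \<Longrightarrow> dcollapse1 (PNode (xs @ s # zs)) (PNode (xs @ t # zs))"

definition domain_equivalent :: "ptree \<Rightarrow> ptree \<Rightarrow> bool" where
  "domain_equivalent s t \<longleftrightarrow> painted s \<and> painted t \<and>
     (\<exists>w. painted w \<and> dcollapse1\<^sup>*\<^sup>* s w \<and> dcollapse1\<^sup>*\<^sup>* t w)"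

text \<open>\<open>paint t ps\<close> paints \<open>t\<close> entirely and grafts the list \<open>ps\<close> to its leaves, in order.\<close>

fun paint :: "utree \<Rightarrow> ptree list \<Rightarrow> ptree"
  and paint_list :: "utree list \<Rightarrow> ptree list \<Rightarrow> ptree list" where
  "paint Leaf ps = hd ps"
| "paint (UNode ts) ps = PNode (paint_list ts ps)"
| "paint_list [] ps = []"
| "paint_list (t # ts) ps =
     paint t (take (leaves t) ps) # paint_list ts (drop (leaves t) ps)"

text \<open>Grafting the two-leaved tree to leaf number \<open>j\<close>, where leaves are numbered from \<open>0\<close>.\<close>

fun ugraft2 :: "nat \<Rightarrow> utree \<Rightarrow> utree"
  and ugraft2_list :: "nat \<Rightarrow> utree list \<Rightarrow> utree list" where
  "ugraft2 j Leaf = (if j = 0 then corolla 2 else Leaf)"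
| "ugraft2 j (UNode ts) = UNode (ugraft2_list j ts)"
| "ugraft2_list j [] = []"
| "ugraft2_list j (t # ts) =
     (if j < leaves t then ugraft2 j t # ts else t # ugraft2_list (j - leaves t) ts)"

fun pgraft2 :: "nat \<Rightarrow> ptree \<Rightarrow> ptree"
  and pgraft2_list :: "nat \<Rightarrow> ptree list \<Rightarrow> ptree list" where
  "pgraft2 j (PNode ts) = PNode (pgraft2_list j ts)"
| "pgraft2 j (MNode ts) = MNode (ugraft2_list j ts)"
| "pgraft2_list j [] = []"
| "pgraft2_list j (t # ts) =
     (if j < pleaves t then pgraft2 j t # ts else t # pgraft2_list (j - pleaves t) ts)"


section \<open>Composihedra\<close>

text \<open>Names for the cells of the recursively constructed complexes \<open>CK(n)\<close>:

  \<^item> \<open>Top n\<close> is the interior of the cone on \<open>\<partial>CK(n)\<close> (the point, for \<open>n = 1\<close>);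

  \<^item> \<open>Upper f [c\<^sub>1, \<dots>, c\<^sub>m]\<close> is the cell \<open>f \<times> c\<^sub>1 \<times> \<dots> \<times> c\<^sub>m\<close> of an upper facet
    \<open>K(m) \<times> CK(r\<^sub>1) \<times> \<dots> \<times> CK(r\<^sub>m)\<close>;

  \<^item> \<open>Lower k c\<close> is the cell \<open>c\<close> of the lower facet \<open>CK\<^sub>k(n-1,2)\<close>, a copy of \<open>CK(n-1)\<close>.

  Names range over the disjoint union of the facets, so a boundary cell may have many names.\<close>

datatype cell = Top nat | Upper utree "cell list" | Lower nat cell

text \<open>\<open>arity c = n\<close> iff \<open>c\<close> names a cell of \<open>CK(n)\<close>.\<close>

fun arity :: "cell \<Rightarrow> nat" where
  "arity (Top n) = n"
| "arity (Upper f cs) = sum_list (map arity cs)"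
| "arity (Lower k c) = Suc (arity c)"

fun is_cell :: "cell \<Rightarrow> bool" where
  "is_cell (Top n) = (1 \<le> n)"
| "is_cell (Upper f cs) =
     (2 \<le> length cs \<and> f \<in> assoc_faces (length cs) \<and> (\<forall>c \<in> set cs. is_cell c))"
| "is_cell (Lower k c) = (1 \<le> k \<and> k \<le> arity c \<and> is_cell c)"

fun cell_dim :: "cell \<Rightarrow> nat" where
  "cell_dim (Top n) = n - 1"
| "cell_dim (Upper f cs) = assoc_dim f + sum_list (map cell_dim cs)"
| "cell_dim (Lower k c) = cell_dim c"

text \<open>The painted tree associated to (a name of) a cell.  On names of facets it gives
  \<open>u(m;r\<^sub>1,\<dots>,r\<^sub>m)\<close> and \<open>l(k,2)\<close>.\<close>

fun cell_tree :: "cell \<Rightarrow> ptree" where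
  "cell_tree (Top n) = painted_corolla n"
| "cell_tree (Upper f cs) = paint f (map cell_tree cs)"
| "cell_tree (Lower k c) = pgraft2 (k - 1) (cell_tree c)"

text \<open>The facet to which the name of a boundary cell belongs.  \<open>Top n\<close> lies in no facet; its
  value is a dummy.\<close>

fun facet_of :: "cell \<Rightarrow> cell" where
  "facet_of (Top n) = Top n"
| "facet_of (Upper f cs) = Upper (corolla (length cs)) (map (\<lambda>c. Top (arity c)) cs)"
| "facet_of (Lower k c) = Lower k (Top (arity c))"

definition is_subfacet :: "cell \<Rightarrow> bool" where
  "is_subfacet s \<longleftrightarrow> is_cell s \<and> cell_dim s + 1 = cell_dim (facet_of s)"

text \<open>The closure order inside a single facet (a product), given the closure order \<open>R\<close> of
  the smaller composihedra.\<close>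

inductive facet_le :: "(cell \<Rightarrow> cell \<Rightarrow> bool) \<Rightarrow> cell \<Rightarrow> cell \<Rightarrow> bool"
  for R :: "cell \<Rightarrow> cell \<Rightarrow> bool" where
  "refines f g \<Longrightarrow> list_all2 R cs ds \<Longrightarrow> facet_le R (Upper f cs) (Upper g ds)"
| "R c d \<Longrightarrow> facet_le R (Lower k c) (Lower k d)"

lemma facet_le_mono [mono]:
  assumes "\<And>x y. R x y \<longrightarrow> S x y"
  shows "facet_le R c d \<longrightarrow> facet_le S c d"
proof
  assume "facet_le R c d"
  then show "facet_le S c d"
    by cases (use assms in \<open>auto intro!: facet_le.intros elim: list_all2_mono\<close>)
qed

text \<open>\<open>cell_le c d\<close>: the cell named \<open>c\<close> lies in the closure of the cell named \<open>d\<close>.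

  Rule \<open>glue\<close> identifies, for sub-facets \<open>s\<close>, \<open>s'\<close> of two facets whose trees are domain
  equivalent, the closed cells \<open>s\<close> and \<open>s'\<close>: a cell \<open>c\<close> of \<open>s\<close> is matched with the cell \<open>d\<close>
  of \<open>s'\<close> that has a domain equivalent tree.  The rule is symmetric, so it makes each of two
  glued names lie below the other.\<close>

inductive cell_le :: "cell \<Rightarrow> cell \<Rightarrow> bool" where
  cone: "is_cell c \<Longrightarrow> cell_le c (Top (arity c))"
| facet: "is_cell c \<Longrightarrow> is_cell d \<Longrightarrow> facet_le cell_le c d \<Longrightarrow> cell_le c d"
| glue: "is_subfacet s \<Longrightarrow> is_subfacet s' \<Longrightarrow> facet_of s \<noteq> facet_of s' \<Longrightarrow>
     domain_equivalent (cell_tree s) (cell_tree s') \<Longrightarrow>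
     is_cell c \<Longrightarrow> is_cell d \<Longrightarrow> facet_le cell_le c s \<Longrightarrow> facet_le cell_le d s' \<Longrightarrow>
     domain_equivalent (cell_tree c) (cell_tree d) \<Longrightarrow> cell_le c d"
| trans: "cell_le c d \<Longrightarrow> cell_le d e \<Longrightarrow> cell_le c e"

text \<open>Two names denote the same cell of the glued complex iff each lies in the closure of the
  other; a cell is the set of its names.\<close>

definition same_cell :: "nat \<Rightarrow> cell rel" where
  "same_cell n = {(c, d). is_cell c \<and> is_cell d \<and> arity c = n \<and> arity d = n \<and>
     cell_le c d \<and> cell_le d c}"

definition compo_cells :: "nat \<Rightarrow> cell set set" where
  "compo_cells n = {c. is_cell c \<and> arity c = n} // same_cell n"

definition composihedron :: "nat \<Rightarrow> cell set rel" where
  "composihedron n = {(X, Y). X \<in> compo_cells n \<and> Y \<in> compo_cells n \<and>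
     (\<exists>c \<in> X. \<exists>d \<in> Y. cell_le c d)}"

definition compo_cells_dim :: "nat \<Rightarrow> nat \<Rightarrow> cell set set" where
  "compo_cells_dim n d = {X \<in> compo_cells n. \<exists>c \<in> X. cell_dim c = d}"


section \<open>Combinatorial equivalence\<close>

definition combinatorially_equivalent :: "'a rel \<Rightarrow> 'b rel \<Rightarrow> bool" where
  "combinatorially_equivalent r s \<longleftrightarrow>
     (\<exists>f. bij_betw f (Field r) (Field s) \<and>
          (\<forall>x \<in> Field r. \<forall>y \<in> Field r. (x, y) \<in> r \<longleftrightarrow> (f x, f y) \<in> s))"

text \<open>Facets and vertices.  \<open>K(n)\<close> has dimension \<open>n - 2\<close>, and \<open>CK(n)\<close> has dimension \<open>n - 1\<close>;
  these are used only where the dimension is positive.\<close>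

definition assoc_facets :: "nat \<Rightarrow> utree set" where
  "assoc_facets n = assoc_faces_dim n (n - 3)"

definition assoc_vertices :: "nat \<Rightarrow> utree set" where
  "assoc_vertices n = assoc_faces_dim n 0"

definition compo_facets :: "nat \<Rightarrow> cell set set" where
  "compo_facets n = compo_cells_dim n (n - 2)"

definition compo_vertices :: "nat \<Rightarrow> cell set set" where
  "compo_vertices n = compo_cells_dim n 0"

end

theory Submission
  imports Defs
begin

text \<open>Up to domain equivalence, a painted tree only remembers, at each node with painted lower
  and unpainted upper edges, the numbers of leaves above these upper edges.  Such reduced trees
  are ordered by splitting one of these numbers in two, by merging all children of a painted node
  when none of them is a painted node of type (2) or (5), and by collapsing painted edges.  For
  every \<open>n\<close>, the tree of a cell identifies the face poset of \<open>CK(n)\<close> with this order: the closure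
  rules can only move up in it, and conversely every name of a cell can be brought to a normal
  form depending on its tree alone by gluing along sub-facets.  What remains is a finite
  comparison: two pentagons for \<open>n = 3\<close>, and for \<open>n = 4\<close> a total of 49 faces against the 45 of
  \<open>K(5)\<close>.\<close>

section \<open>Painted trees up to domain equivalence\<close>

text \<open>A boundary cell may have many names, and \<open>glue\<close> only compares sub-facets of
  two different facets; the obstacle is to show that all names with one tree are nevertheless
  identified. Three exchanges, each coming from one pair of glued sub-facets, suffice: two upper
  facets (a painted subtree belongs to the associahedron factor or to one composihedron factor), an
  upper and a lower facet (a pair of leaves is grafted after or before the painted grafting), and
  two lower facets (two pairs are grafted in either order). They are the associativity laws of
  grafting. The same care is needed for the order: splitting a number or merging blocks need not be
  a step inside one facet of the normal forms. When the result is the corolla, \<open>cone\<close>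
  gives the relation; every other instance arises from this one by grafting pairs of leaves on both
  sides, which raises the numbers one at a time. Conversely, two names below each other have the
  same tree because the dimension grows strictly along the order on trees.\<close>

datatype dtree = is_Block: Block (labels: "nat list") | Branch "dtree list"

fun dsize :: "dtree \<Rightarrow> nat" where
  "dsize (Block ns) = sum_list ns"
| "dsize (Branch ts) = sum_list (map dsize ts)"

fun proper :: "dtree \<Rightarrow> bool" where
  "proper (Block ns) \<longleftrightarrow> ns \<noteq> [] \<and> (\<forall>n \<in> set ns. 1 \<le> n)"
| "proper (Branch ts) \<longleftrightarrow> 2 \<le> length ts \<and> (\<forall>t \<in> set ts. proper t)"

text \<open>A \<open>Block\<close> with k entries contributes k - 1, the dimension of CK(k), and a
  \<open>Branch\<close> with k children contributes k - 2, the dimension of K(k). On proper trees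
  neither subtraction truncates.\<close>

fun ddim :: "dtree \<Rightarrow> nat" where
  "ddim (Block ns) = length ns - 1"
| "ddim (Branch ts) = length ts - 2 + sum_list (map ddim ts)"

fun canon :: "ptree \<Rightarrow> dtree" where
  "canon (PNode ts) = Branch (map canon ts)"
| "canon (MNode us) = Block (map leaves us)"

lemma leaves_pos: "unpainted u \<Longrightarrow> 1 \<le> leaves u"
proof (induction u)
  case (UNode ts)
  then obtain t ts' where ts: "ts = t # ts'"
    by (cases ts) auto
  with UNode have "1 \<le> leaves t" by simp
  with ts show ?case by simp
qed simp

lemma proper_canon: "painted p \<Longrightarrow> proper (canon p)"
  using leaves_pos by (induction p) fastforce+

lemma dsize_canon: "dsize (canon p) = pleaves p"
proof (induction p)
  case (PNode ts)
  then show ?case by (simp add: o_def cong: map_cong)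
qed simp

lemma dsize_pos: "proper t \<Longrightarrow> 1 \<le> dsize t"
proof (induction t)
  case (Block ns)
  then show ?case by (cases ns) auto
next
  case (Branch ts)
  then obtain t ts' where ts: "ts = t # ts'"
    by (cases ts) auto
  with Branch have "1 \<le> dsize t" by simp
  with ts show ?case by simp
qed

lemma collapse1_leaves: "collapse1 s t \<Longrightarrow> leaves s = leaves t"
  by (induction rule: collapse1.induct) auto

lemma refines_leaves: "refines s t \<Longrightarrow> leaves s = leaves t"
  unfolding refines_def by (induction rule: rtranclp_induct) (auto dest: collapse1_leaves)

lemma dcollapse1_canon: "dcollapse1 s t \<Longrightarrow> canon s = canon t"
  by (induction rule: dcollapse1.induct) (auto dest: collapse1_leaves)

lemma dcollapse_canon: "dcollapse1\<^sup>*\<^sup>* s t \<Longrightarrow> canon s = canon t"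
  by (induction rule: rtranclp_induct) (auto dest: dcollapse1_canon)

lemma refines_context:
  "refines s t \<Longrightarrow> refines (UNode (xs @ s # zs)) (UNode (xs @ t # zs))"
  unfolding refines_def
proof (induction rule: rtranclp_induct)
  case (step t u)
  then show ?case by (meson collapse1.intros(2) rtranclp.rtrancl_into_rtrancl)
qed simp

lemma refines_trans [trans]: "refines s t \<Longrightarrow> refines t u \<Longrightarrow> refines s u"
  unfolding refines_def by simp

lemma refines_refl [simp]: "refines s s"
  unfolding refines_def by simp

lemma collapse1_refines: "collapse1 s t \<Longrightarrow> refines s t"
  unfolding refines_def by blast

text \<open>Only edges between two nodes collapse, so \<open>t\<close> is dissolved inside a parent:
  first the edge below \<open>t\<close> goes, then the edges below its children.\<close>

lemma refines_flatten:
  "refines (UNode (xs @ t # zs)) (UNode (xs @ replicate (leaves t) Leaf @ zs))"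
proof (induction t arbitrary: xs zs)
  case (UNode ts)
  \<comment> \<open>The children are dissolved from left to right; the leaves already obtained move
    into the prefix, which is therefore arbitrary.\<close>
  have "refines (UNode (xs @ us @ zs)) (UNode (xs @ replicate (sum_list (map leaves us)) Leaf @ zs))"
    if "set us \<subseteq> set ts" for us xs
    using that
  proof (induction us arbitrary: xs)
    case (Cons u us)
    have "refines (UNode (xs @ u # us @ zs)) (UNode (xs @ replicate (leaves u) Leaf @ us @ zs))"
      using UNode Cons.prems by auto
    also have "refines \<dots> (UNode ((xs @ replicate (leaves u) Leaf) @
        replicate (sum_list (map leaves us)) Leaf @ zs))"
      using Cons.IH[of "xs @ replicate (leaves u) Leaf"] Cons.prems by simp
    finally show ?case by (simp add: replicate_add)
  qed simp
  from this[of ts xs] show ?case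
    using refines_trans[OF collapse1_refines[OF collapse1.intros(1)]] by auto
qed simp

lemma refines_flatten_list:
  "refines (UNode (xs @ us @ zs)) (UNode (xs @ replicate (sum_list (map leaves us)) Leaf @ zs))"
proof (induction us arbitrary: xs)
  case (Cons u us)
  have "refines (UNode (xs @ u # us @ zs)) (UNode (xs @ replicate (leaves u) Leaf @ us @ zs))"
    by (rule refines_flatten)
  also have "refines \<dots> (UNode ((xs @ replicate (leaves u) Leaf) @
      replicate (sum_list (map leaves us)) Leaf @ zs))"
    using Cons.IH[of "xs @ replicate (leaves u) Leaf"] by simp
  finally show ?case by (simp add: replicate_add)
qed simp

lemma refines_corolla: "refines (UNode us) (corolla (leaves (UNode us)))"
  using refines_flatten_list[of "[]" us "[]"] by (simp add: corolla_def)

lemma leaves_corolla [simp]: "leaves (corolla n) = n"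
  by (simp add: corolla_def sum_list_replicate)

lemma corolla_eq_iff [simp]: "corolla m = corolla n \<longleftrightarrow> m = n"
  by (metis leaves_corolla)

lemma nodes_corolla [simp]: "nodes (corolla n) = 1"
  by (simp add: corolla_def sum_list_replicate)

lemma unpainted_corolla: "2 \<le> n \<Longrightarrow> unpainted (corolla n)"
  by (simp add: corolla_def)

lemma leaves_ge_length: "\<forall>u \<in> set us. unpainted u \<Longrightarrow> length us \<le> sum_list (map leaves us)"
  by (induction us) (auto dest!: leaves_pos)

text \<open>The coarsest unpainted tree with n leaves. One leaf is special because an unpainted node
  needs at least two upper edges.\<close>

definition bush :: "nat \<Rightarrow> utree" where
  "bush n = (if n = 1 then Leaf else corolla n)"

lemma refines_bush: "unpainted u \<Longrightarrow> refines u (bush (leaves u))"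
proof (cases u)
  case (UNode us)
  assume "unpainted u"
  then have "2 \<le> leaves u"
    using leaves_ge_length[of us] UNode by auto
  then show ?thesis
    using refines_corolla[of us] UNode by (simp add: bush_def)
qed (simp add: bush_def)

lemma unpainted_bush: "1 \<le> n \<Longrightarrow> unpainted (bush n)"
  by (auto simp: bush_def unpainted_corolla)

fun of_dtree :: "dtree \<Rightarrow> ptree" where
  "of_dtree (Block ns) = MNode (map bush ns)"
| "of_dtree (Branch ts) = PNode (map of_dtree ts)"

lemma painted_of_dtree: "proper t \<Longrightarrow> painted (of_dtree t)"
  by (induction t) (auto simp: unpainted_bush Suc_le_eq)

lemma dcollapse_MNode_context:
  "refines s t \<Longrightarrow> dcollapse1\<^sup>*\<^sup>* (MNode (xs @ s # zs)) (MNode (xs @ t # zs))"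
  unfolding refines_def
proof (induction rule: rtranclp_induct)
  case (step t u)
  then show ?case by (meson dcollapse1.intros(1) rtranclp.rtrancl_into_rtrancl)
qed simp

lemma dcollapse_PNode_context:
  "dcollapse1\<^sup>*\<^sup>* s t \<Longrightarrow> dcollapse1\<^sup>*\<^sup>* (PNode (xs @ s # zs)) (PNode (xs @ t # zs))"
proof (induction rule: rtranclp_induct)
  case (step t u)
  then show ?case by (meson dcollapse1.intros(2) rtranclp.rtrancl_into_rtrancl)
qed simp

lemma dcollapse_of_dtree: "painted p \<Longrightarrow> dcollapse1\<^sup>*\<^sup>* p (of_dtree (canon p))"
proof (induction p)
  case (PNode ts)
  have "dcollapse1\<^sup>*\<^sup>* (PNode (xs @ us)) (PNode (xs @ map (of_dtree \<circ> canon) us))"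
    if "set us \<subseteq> set ts" for us xs
    using that
  proof (induction us arbitrary: xs)
    case (Cons u us)
    then have "dcollapse1\<^sup>*\<^sup>* (PNode (xs @ u # us)) (PNode (xs @ of_dtree (canon u) # us))"
      using PNode by (intro dcollapse_PNode_context) auto
    then show ?case
      using Cons.IH[of "xs @ [of_dtree (canon u)]"] Cons.prems by auto
  qed simp
  from this[of ts "[]"] show ?case by simp
next
  case (MNode ts)
  have "dcollapse1\<^sup>*\<^sup>* (MNode (xs @ us)) (MNode (xs @ map (bush \<circ> leaves) us))"
    if "set us \<subseteq> set ts" for us xs
    using that
  proof (induction us arbitrary: xs)
    case (Cons u us)
    then have "dcollapse1\<^sup>*\<^sup>* (MNode (xs @ u # us)) (MNode (xs @ bush (leaves u) # us))"
      using MNode by (intro dcollapse_MNode_context refines_bush) auto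
    then show ?case
      using Cons.IH[of "xs @ [bush (leaves u)]"] Cons.prems by auto
  qed simp
  from this[of ts "[]"] show ?case by simp
qed

text \<open>The permitted collapses keep every \<open>MNode\<close> and the number of leaves above
  each of its upper edges, so \<open>canon\<close> is invariant. Conversely,
  \<open>of_dtree (canon s)\<close> is a common collapse of all painted trees with this reduced
  form.\<close>

lemma domain_equivalent_iff:
  "domain_equivalent s t \<longleftrightarrow> painted s \<and> painted t \<and> canon s = canon t"
proof
  assume "domain_equivalent s t"
  then show "painted s \<and> painted t \<and> canon s = canon t"
    unfolding domain_equivalent_def by (metis dcollapse_canon)
next
  assume "painted s \<and> painted t \<and> canon s = canon t"
  then show "domain_equivalent s t"
    unfolding domain_equivalent_def
    by (metis dcollapse_of_dtree painted_of_dtree proper_canon)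
qed


section \<open>Grafting\<close>

text \<open>\<^term>\<open>update_at sz g j xs\<close> applies \<^term>\<open>g\<close> to the item of \<^term>\<open>xs\<close> that contains
  position \<^term>\<open>j\<close> when the items are laid out consecutively with sizes \<^term>\<open>sz\<close>; the first
  argument of \<^term>\<open>g\<close> is the position relative to that item.\<close>

fun update_at :: "('a \<Rightarrow> nat) \<Rightarrow> (nat \<Rightarrow> 'a \<Rightarrow> 'a) \<Rightarrow> nat \<Rightarrow> 'a list \<Rightarrow> 'a list" where
  "update_at sz g j [] = []"
| "update_at sz g j (x # xs) =
     (if j < sz x then g j x # xs else x # update_at sz g (j - sz x) xs)"

text \<open>Tells the function package that \<open>g\<close> is called on members of the list only,
  which makes the recursion of \<open>bump\<close> through the children terminate.\<close>

lemma update_at_cong [fundef_cong]: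
  assumes "sz = sz'" "j = j'" "xs = xs'" "\<And>i x. x \<in> set xs' \<Longrightarrow> g i x = g' i x"
  shows "update_at sz g j xs = update_at sz' g' j' xs'"
  using assms(4) unfolding assms(1-3) by (induction xs' arbitrary: j') auto

lemma update_at_append:
  "update_at sz g j (xs @ ys) =
    (if j < sum_list (map sz xs) then update_at sz g j xs @ ys
     else xs @ update_at sz g (j - sum_list (map sz xs)) ys)"
  by (induction xs arbitrary: j) auto

lemma length_update_at [simp]: "length (update_at sz g j xs) = length xs"
  by (induction xs arbitrary: j) auto

lemma sum_list_update_at:
  assumes "\<And>i x. x \<in> set xs \<Longrightarrow> i < sz x \<Longrightarrow> sz (g i x) = Suc (sz x)"
  shows "j < sum_list (map sz xs) \<Longrightarrow>
    sum_list (map sz (update_at sz g j xs)) = Suc (sum_list (map sz xs))"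
  using assms by (induction xs arbitrary: j) auto

text \<open>Enlarging at \<open>i\<close> shifts all later positions by one, so position
  \<open>j\<close> afterwards was position \<open>j - 1\<close> before.\<close>

lemma update_at_update_at:
  assumes "\<And>i x. x \<in> set xs \<Longrightarrow> i < sz x \<Longrightarrow> sz (g i x) = Suc (sz x)"
    and "\<And>i j x. x \<in> set xs \<Longrightarrow> i < j \<Longrightarrow> j \<le> sz x \<Longrightarrow> g j (g i x) = g i (g (j - 1) x)"
  shows "i < j \<Longrightarrow> j \<le> sum_list (map sz xs) \<Longrightarrow>
    update_at sz g j (update_at sz g i xs) = update_at sz g i (update_at sz g (j - 1) xs)"
  using assms
proof (induction xs arbitrary: i j)
  case (Cons x xs)
  show ?case
  proof (cases "i < sz x")
    case True
    show ?thesis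
    proof (cases "j \<le> sz x")
      case True
      then have "j - 1 < sz x" using Cons.prems(1) by simp
      with True \<open>i < sz x\<close> Cons.prems show ?thesis by (auto simp: less_Suc_eq_le)
    next
      case False
      then show ?thesis using \<open>i < sz x\<close> Cons.prems(1,3) by (auto simp: less_Suc_eq_le)
    qed
  next
    case False
    then have "update_at sz g (j - sz x) (update_at sz g (i - sz x) xs) =
      update_at sz g (i - sz x) (update_at sz g (j - sz x - 1) xs)"
      using Cons.prems by (intro Cons.IH) auto
    with False Cons.prems(1) show ?thesis
      by (auto simp: diff_commute)
  qed
qed simp

lemma position_split:
  fixes sz :: "'a \<Rightarrow> nat"
  assumes "j < sum_list (map sz xs)"
  obtains as x bs where "xs = as @ x # bs" "sum_list (map sz as) \<le> j"
    "j < sum_list (map sz as) + sz x"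
  using assms
proof (induction xs arbitrary: j thesis)
  case (Cons y ys)
  show ?case
  proof (cases "j < sz y")
    case True
    then show ?thesis using Cons.prems(1)[of "[]" y ys] by simp
  next
    case False
    with Cons.prems(2) have "j - sz y < sum_list (map sz ys)" by simp
    then obtain as x bs where "ys = as @ x # bs" "sum_list (map sz as) \<le> j - sz y"
      "j - sz y < sum_list (map sz as) + sz x"
      using Cons.IH by blast
    then show ?thesis using False Cons.prems(1)[of "y # as" x bs] by auto
  qed
qed simp

abbreviation incr :: "nat \<Rightarrow> nat list \<Rightarrow> nat list" where
  "incr \<equiv> update_at (\<lambda>n. n) (\<lambda>_. Suc)"

fun bump :: "nat \<Rightarrow> dtree \<Rightarrow> dtree" where
  "bump j (Block ns) = Block (incr j ns)"
| "bump j (Branch ts) = Branch (update_at dsize bump j ts)"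

lemma dsize_bump: "j < dsize t \<Longrightarrow> dsize (bump j t) = Suc (dsize t)"
proof (induction t arbitrary: j)
  case (Block ns)
  then show ?case using sum_list_update_at[of ns "\<lambda>n. n" "\<lambda>_. Suc" j] by simp
next
  case (Branch ts)
  then show ?case using sum_list_update_at[of ts dsize bump j] by simp
qed

lemma ddim_bump: "ddim (bump j t) = ddim t"
proof (induction t arbitrary: j)
  case (Branch ts)
  then have "sum_list (map ddim (update_at dsize bump j ts)) = sum_list (map ddim ts)"
    by (induction ts arbitrary: j) auto
  then show ?case by simp
qed simp

text \<open>For \<open>j = i + 1\<close> the painted trees behind the two sides differ: the second
  pair sits on the right or on the left leaf of the first. Only a leaf count survives in the reduced
  tree, so the sides agree; this is where domain equivalence enters.\<close>

lemma bump_bump: "i < j \<Longrightarrow> j \<le> dsize t \<Longrightarrow> bump j (bump i t) = bump i (bump (j - 1) t)"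
proof (induction t arbitrary: i j)
  case (Block ns)
  then show ?case using update_at_update_at[of ns "\<lambda>n. n" "\<lambda>_. Suc" i j] by simp
next
  case (Branch ts)
  then show ?case using update_at_update_at[of ts dsize bump i j] by (simp add: dsize_bump)
qed

lemma leaves_ugraft2:
  "j < leaves t \<Longrightarrow> leaves (ugraft2 j t) = Suc (leaves t)"
  "map leaves (ugraft2_list j ts) = incr j (map leaves ts)"
proof (induction j t and j ts rule: ugraft2_ugraft2_list.induct)
  case (2 j ts)
  then show ?case using sum_list_update_at[of "map leaves ts" "\<lambda>n. n" "\<lambda>_. Suc" j] by simp
qed (auto simp: corolla_def numeral_2_eq_2)

lemma length_ugraft2_list [simp]: "length (ugraft2_list j ts) = length ts"
  by (induction ts arbitrary: j) auto

lemma unpainted_ugraft2: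
  "unpainted t \<Longrightarrow> unpainted (ugraft2 j t)"
  "\<forall>t \<in> set ts. unpainted t \<Longrightarrow> \<forall>t \<in> set (ugraft2_list j ts). unpainted t"
  by (induction j t and j ts rule: ugraft2_ugraft2_list.induct) (auto simp: unpainted_corolla)

lemma canon_pgraft2:
  "canon (pgraft2 j t) = bump j (canon t)"
  "map canon (pgraft2_list j ts) = update_at dsize bump j (map canon ts)"
  by (induction j t and j ts rule: pgraft2_pgraft2_list.induct)
    (auto simp: leaves_ugraft2 dsize_canon)

lemma length_pgraft2_list [simp]: "length (pgraft2_list j ts) = length ts"
  by (induction ts arbitrary: j) auto

lemma painted_pgraft2:
  "painted t \<Longrightarrow> painted (pgraft2 j t)"
  "\<forall>t \<in> set ts. painted t \<Longrightarrow> \<forall>t \<in> set (pgraft2_list j ts). painted t"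
  by (induction j t and j ts rule: pgraft2_pgraft2_list.induct)
    (auto simp: unpainted_ugraft2)

fun graft :: "utree \<Rightarrow> dtree list \<Rightarrow> dtree"
  and graft_list :: "utree list \<Rightarrow> dtree list \<Rightarrow> dtree list" where
  "graft Leaf ds = hd ds"
| "graft (UNode ts) ds = Branch (graft_list ts ds)"
| "graft_list [] ds = []"
| "graft_list (t # ts) ds =
     graft t (take (leaves t) ds) # graft_list ts (drop (leaves t) ds)"

lemma canon_paint:
  "leaves f = length ps \<Longrightarrow> canon (paint f ps) = graft f (map canon ps)"
  "sum_list (map leaves fs) = length ps \<Longrightarrow>
    map canon (paint_list fs ps) = graft_list fs (map canon ps)"
proof (induction f ps and fs ps rule: paint_paint_list.induct)
  case (1 ps)
  then show ?case by (cases ps) auto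
qed (auto simp: take_map drop_map)

lemma length_paint_list [simp]: "length (paint_list fs ps) = length fs"
  by (induction fs arbitrary: ps) auto

lemma painted_paint:
  "leaves f = length ps \<Longrightarrow> unpainted f \<Longrightarrow> \<forall>p \<in> set ps. painted p \<Longrightarrow> painted (paint f ps)"
  "sum_list (map leaves fs) = length ps \<Longrightarrow> \<forall>f \<in> set fs. unpainted f \<Longrightarrow>
    \<forall>p \<in> set ps. painted p \<Longrightarrow> \<forall>p \<in> set (paint_list fs ps). painted p"
proof (induction f ps and fs ps rule: paint_paint_list.induct)
  case (1 ps)
  then show ?case by (cases ps) auto
next
  case (4 t ts ps)
  have "\<forall>p \<in> set (take (leaves t) ps). painted p" "\<forall>p \<in> set (drop (leaves t) ps). painted p"
    using 4(5) by (auto dest: in_set_takeD in_set_dropD)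
  with 4 show ?case by auto
qed auto

lemma dsize_graft:
  "leaves f = length ds \<Longrightarrow> dsize (graft f ds) = sum_list (map dsize ds)"
  "sum_list (map leaves fs) = length ds \<Longrightarrow>
    sum_list (map dsize (graft_list fs ds)) = sum_list (map dsize ds)"
proof (induction f ds and fs ds rule: graft_graft_list.induct)
  case (1 ds)
  then show ?case by (cases ds) auto
next
  case (4 t ts ds)
  then have "sum_list (map dsize (graft_list (t # ts) ds)) =
    sum_list (map dsize (take (leaves t) ds @ drop (leaves t) ds))"
    unfolding map_append sum_list_append by simp
  then show ?case by simp
qed auto

lemma graft_list_append:
  assumes "length as = sum_list (map leaves xs)"
  shows "graft_list (xs @ ys) (as @ bs) = graft_list xs as @ graft_list ys bs"
  using assms by (induction xs arbitrary: as) auto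

lemma graft_list_Leafs: "graft_list (replicate (length ds) Leaf) ds = ds"
  by (induction ds) auto

lemma graft_corolla: "graft (corolla (length ds)) ds = Branch ds"
  by (simp add: corolla_def graft_list_Leafs)

lemma length_graft_list [simp]: "length (graft_list fs ds) = length fs"
  by (induction fs arbitrary: ds) auto

text \<open>Ensures that \<open>leaves f - 1 - nodes f\<close> is a true difference for unpainted
  trees.\<close>

lemma nodes_less_leaves: "unpainted f \<Longrightarrow> nodes f < leaves f"
proof (induction f)
  case (UNode ts)
  \<comment> \<open>The strict bounds of the children gain one for each child; the two or more
    children pay for the root node and leave the inequality strict.\<close>
  have "sum_list (map nodes us) + length us \<le> sum_list (map leaves us)"
    if "set us \<subseteq> set ts" for us
    using that
  proof (induction us)
    case (Cons u us)
    then have "nodes u < leaves u" using UNode by auto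
    with Cons show ?case by auto
  qed simp
  from this[of ts] UNode.prems show ?case by auto
qed simp

text \<open>Written additively, because \<^const>\<open>assoc_dim\<close> truncates on a single leaf.\<close>

lemma ddim_graft_add:
  "leaves f = length ds \<Longrightarrow> unpainted f \<Longrightarrow>
    ddim (graft f ds) + nodes f + 1 = leaves f + sum_list (map ddim ds)"
  "sum_list (map leaves fs) = length ds \<Longrightarrow> \<forall>f \<in> set fs. unpainted f \<Longrightarrow>
    sum_list (map ddim (graft_list fs ds)) + sum_list (map nodes fs) + length fs =
      sum_list (map leaves fs) + sum_list (map ddim ds)"
proof (induction f ds and fs ds rule: graft_graft_list.induct)
  case (1 ds)
  then show ?case by (cases ds) auto
next
  case (2 ts ds)
  then show ?case by auto
next
  case (4 t ts ds)
  then have "ddim (graft t (take (leaves t) ds)) + nodes t + 1 =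
      leaves t + sum_list (map ddim (take (leaves t) ds))"
    and "sum_list (map ddim (graft_list ts (drop (leaves t) ds))) + sum_list (map nodes ts) +
      length ts = sum_list (map leaves ts) + sum_list (map ddim (drop (leaves t) ds))"
    by auto
  moreover have "sum_list (map ddim ds) = sum_list (map ddim (take (leaves t) ds)) +
      sum_list (map ddim (drop (leaves t) ds))"
    by (metis append_take_drop_id map_append sum_list_append)
  ultimately show ?case by simp
qed auto

lemma ddim_graft:
  "leaves f = length ds \<Longrightarrow> unpainted f \<Longrightarrow>
    ddim (graft f ds) = assoc_dim f + sum_list (map ddim ds)"
  using ddim_graft_add(1)[of f ds] nodes_less_leaves[of f] by (simp add: assoc_dim_def)


section \<open>The face order\<close>

text \<open>On proper trees every rule goes up by exactly one dimension. \<open>split\<close> stands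
  for collapsing the edge from a node of type (3) or (6) to a binary node above it, which some
  domain equivalent tree has. \<open>absorb\<close> must take all children at once, since no node
  may have both painted and unpainted upper edges.\<close>

inductive dstep :: "dtree \<Rightarrow> dtree \<Rightarrow> bool" where
  split: "1 \<le> a \<Longrightarrow> 1 \<le> b \<Longrightarrow> dstep (Block (xs @ (a + b) # zs)) (Block (xs @ a # b # zs))"
| absorb: "dstep (Branch (map Block nss)) (Block (concat nss))"
| merge: "dstep (Branch (xs @ Branch ys # zs)) (Branch (xs @ ys @ zs))"
| inner: "dstep s t \<Longrightarrow> dstep (Branch (xs @ s # zs)) (Branch (xs @ t # zs))"

abbreviation dle :: "dtree \<Rightarrow> dtree \<Rightarrow> bool" where
  "dle \<equiv> dstep\<^sup>*\<^sup>*"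

lemma dstep_proper: "dstep s t \<Longrightarrow> proper s \<Longrightarrow> proper t"
proof (induction rule: dstep.induct)
  case (absorb nss)
  then show ?case by (cases nss) auto
qed auto

lemma sum_list_concat: "sum_list (concat xss) = sum_list (map sum_list xss)"
  by (induction xss) auto

lemma dstep_dsize: "dstep s t \<Longrightarrow> dsize s = dsize t"
  by (induction rule: dstep.induct) (auto simp: sum_list_concat o_def)

lemma dstep_ddim: "dstep s t \<Longrightarrow> proper s \<Longrightarrow> ddim t = Suc (ddim s)"
proof (induction rule: dstep.induct)
  case (absorb nss)
  \<comment> \<open>With k blocks and L entries altogether, the dimension before absorption is (k -
    2) + (L - k) = L - 2, and L - 1 afterwards.\<close>
  have "sum_list (map (\<lambda>ns. length ns - 1) nss) + length nss = length (concat nss)"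
    if "\<forall>ns \<in> set nss. ns \<noteq> []" for nss :: "nat list list"
    using that by (induction nss) (auto simp: Suc_le_eq)
  from this[of nss] absorb show ?case
    by (auto simp: o_def)
qed auto

lemma dle_proper: "dle s t \<Longrightarrow> proper s \<Longrightarrow> proper t"
  by (induction rule: rtranclp_induct) (auto dest: dstep_proper)

lemma dle_dsize: "dle s t \<Longrightarrow> dsize s = dsize t"
  by (induction rule: rtranclp_induct) (auto dest: dstep_dsize)

lemma dle_ddim:
  assumes "dle s t" "proper s"
  shows "s = t \<or> ddim s < ddim t"
proof -
  from assms have "proper t \<and> (s = t \<or> ddim s < ddim t)"
    by (induction rule: rtranclp_induct) (auto dest: dstep_proper dstep_ddim)
  then show ?thesis ..
qed

lemma dle_antisym: "dle s t \<Longrightarrow> dle t s \<Longrightarrow> proper s \<Longrightarrow> s = t"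
  using dle_ddim[of s t] dle_ddim[of t s] dle_proper[of s t] by auto

lemma dle_context: "dle s t \<Longrightarrow> dle (Branch (xs @ s # zs)) (Branch (xs @ t # zs))"
proof (induction rule: rtranclp_induct)
  case (step t u)
  then show ?case by (meson dstep.inner rtranclp.rtrancl_into_rtrancl)
qed simp

lemma dle_Branch: "list_all2 dle ts us \<Longrightarrow> dle (Branch (xs @ ts)) (Branch (xs @ us))"
proof (induction arbitrary: xs rule: list_all2_induct)
  case (Cons t ts u us)
  have "dle (Branch (xs @ t # ts)) (Branch (xs @ u # ts))"
    by (rule dle_context) fact
  also have "dle \<dots> (Branch (xs @ u # us))"
    using Cons.IH[of "xs @ [u]"] by simp
  finally show ?case .
qed simp

lemma dle_replicate:
  "1 \<le> n \<Longrightarrow> dle (Block (xs @ n # zs)) (Block (xs @ replicate n 1 @ zs))"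
proof (induction n arbitrary: xs rule: dec_induct)
  case (step n)
  have "dle (Block (xs @ Suc n # zs)) (Block (xs @ 1 # n # zs))"
    using dstep.split[of 1 n xs zs] step.hyps by auto
  also have "dle \<dots> (Block (xs @ replicate (Suc n) 1 @ zs))"
    using step.IH[of "xs @ [1]"] by simp
  finally show ?case .
qed simp

lemma dle_Block_ones:
  "\<forall>n \<in> set ns. 1 \<le> n \<Longrightarrow> dle (Block (xs @ ns)) (Block (xs @ replicate (sum_list ns) 1))"
proof (induction ns arbitrary: xs)
  case (Cons n ns)
  then have "dle (Block (xs @ n # ns)) (Block (xs @ replicate n 1 @ ns))"
    by (intro dle_replicate) simp
  also have "dle \<dots> (Block (xs @ replicate (sum_list (n # ns)) 1))"
    using Cons.IH[of "xs @ replicate n 1"] Cons.prems by (simp add: replicate_add)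
  finally show ?case .
qed simp

lemma concat_map_replicate:
  "concat (map (\<lambda>x. replicate (f x) a) xs) = replicate (sum_list (map f xs)) a"
  by (induction xs) (auto simp: replicate_add)

text \<open>Every child of a \<open>Branch\<close> is first raised to a block of ones; then all
  children are blocks and can be absorbed together.\<close>

lemma dle_top: "proper t \<Longrightarrow> dle t (Block (replicate (dsize t) 1))"
proof (induction t)
  case (Block ns)
  then show ?case using dle_Block_ones[of ns "[]"] by simp
next
  case (Branch ts)
  let ?f = "\<lambda>t. replicate (dsize t) (1::nat)"
  have "list_all2 dle ts (map (Block \<circ> ?f) ts)"
    using Branch by (auto simp: list_all2_conv_all_nth)
  then have "dle (Branch ts) (Branch (map Block (map ?f ts)))"
    using dle_Branch[of ts _ "[]"] by simp
  also have "dstep \<dots> (Block (concat (map ?f ts)))"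
    by (rule dstep.absorb)
  finally show ?case by (simp add: concat_map_replicate)
qed

lemma incr_concat:
  "incr j (concat nss) = concat (update_at sum_list incr j nss)"
  by (induction nss arbitrary: j) (auto simp: update_at_append)

lemma update_at_map_Block:
  "update_at dsize bump j (map Block nss) = map Block (update_at sum_list incr j nss)"
  by (induction nss arbitrary: j) auto

lemma dstep_bump: "dstep s t \<Longrightarrow> j < dsize s \<Longrightarrow> dstep (bump j s) (bump j t)"
proof (induction arbitrary: j rule: dstep.induct)
  case (split a b xs zs)
  let ?k = "j - sum_list xs"
  \<comment> \<open>Leaf \<open>j\<close> lies before the split entry, in its first part, in its
    second part, or after it. The two middle cases are splits of \<open>a + b + 1\<close> with the
    extra leaf in the corresponding part.\<close>
  consider "j < sum_list xs" | "sum_list xs \<le> j" "?k < a" |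
    "sum_list xs \<le> j" "a \<le> ?k" "?k < a + b" | "sum_list xs \<le> j" "a + b \<le> ?k"
    by linarith
  then show ?case
  proof cases
    case 1
    then show ?thesis using dstep.split[OF split.hyps] by (simp add: update_at_append)
  next
    case 2
    then show ?thesis using dstep.split[of "Suc a" b xs zs] split.hyps
      by (simp add: update_at_append)
  next
    case 3
    then show ?thesis using dstep.split[of a "Suc b" xs zs] split.hyps
      by (auto simp: update_at_append)
  next
    case 4
    then show ?thesis
      using dstep.split[OF split.hyps] by (auto simp: update_at_append add.assoc)
  qed
next
  case (absorb nss)
  show ?case by (simp add: incr_concat update_at_map_Block dstep.absorb)
next
  case (merge xs ys zs)
  let ?u = "update_at dsize bump"
  show ?case
    using dstep.merge[of "?u j xs" ys zs] dstep.merge[of xs "?u (j - sum_list (map dsize xs)) ys" zs]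
      dstep.merge[of xs ys "?u (j - sum_list (map dsize xs) - sum_list (map dsize ys)) zs"]
    by (simp add: update_at_append)
next
  case (inner s t xs zs)
  let ?u = "update_at dsize bump"
  have "dsize s = dsize t" using inner.hyps by (rule dstep_dsize)
  moreover have "dstep (bump (j - sum_list (map dsize xs)) s) (bump (j - sum_list (map dsize xs)) t)"
    if "j - sum_list (map dsize xs) < dsize s"
    using inner.IH that .
  ultimately show ?case
    using inner.hyps by (simp add: update_at_append dstep.inner)
qed

lemma dle_bump: "dle s t \<Longrightarrow> j < dsize s \<Longrightarrow> dle (bump j s) (bump j t)"
proof (induction rule: rtranclp_induct)
  case (step t u)
  then show ?case using dstep_bump[of t u j] dle_dsize[of s t] by auto
qed simp

lemma list_split_lengths:
  assumes "length ds = k + l + m"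
  obtains as bs cs where "ds = as @ bs @ cs" "length as = k" "length bs = l" "length cs = m"
proof
  show "ds = take k ds @ take l (drop k ds) @ drop l (drop k ds)"
    by (simp del: drop_drop)
qed (use assms in auto)

text \<open>An internal edge of \<open>f\<close> becomes an edge between two painted nodes after
  grafting, so its collapse is a \<open>merge\<close> below some number of \<open>inner\<close>
  steps.\<close>

lemma graft_collapse1:
  "collapse1 f g \<Longrightarrow> length ds = leaves f \<Longrightarrow> dstep (graft f ds) (graft g ds)"
proof (induction arbitrary: ds rule: collapse1.induct)
  case (1 xs ys zs)
  then have "length ds =
    sum_list (map leaves xs) + sum_list (map leaves ys) + sum_list (map leaves zs)" by simp
  then obtain as bs cs where "ds = as @ bs @ cs" "length as = sum_list (map leaves xs)"
    "length bs = sum_list (map leaves ys)" "length cs = sum_list (map leaves zs)"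
    by (rule list_split_lengths)
  then show ?case by (simp add: graft_list_append dstep.merge)
next
  case (2 s t xs zs)
  then have "length ds = sum_list (map leaves xs) + leaves s + sum_list (map leaves zs)" by simp
  then obtain as bs cs where "ds = as @ bs @ cs" "length as = sum_list (map leaves xs)"
    "length bs = leaves s" "length cs = sum_list (map leaves zs)"
    by (rule list_split_lengths)
  with 2 show ?case by (simp add: graft_list_append collapse1_leaves dstep.inner)
qed

lemma graft_refines:
  assumes "refines f g" "length ds = leaves f"
  shows "dle (graft f ds) (graft g ds)"
  using assms(1)[unfolded refines_def]
proof (induction rule: rtranclp_induct)
  case (step g h)
  then have "leaves f = leaves g" by (intro refines_leaves) (simp add: refines_def)
  with step graft_collapse1[of g h ds] assms(2) show ?case by auto
qed simp

lemma graft_mono: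
  "list_all2 dle ds es \<Longrightarrow> length ds = leaves f \<Longrightarrow> dle (graft f ds) (graft f es)"
  "list_all2 dle ds es \<Longrightarrow> length ds = sum_list (map leaves fs) \<Longrightarrow>
    list_all2 dle (graft_list fs ds) (graft_list fs es)"
proof (induction f ds and fs ds arbitrary: es and es rule: graft_graft_list.induct)
  case (1 ds)
  then show ?case by (cases ds; cases es) auto
next
  case (2 ts ds)
  then show ?case using dle_Branch[of _ _ "[]"] by simp
next
  case (4 t ts ds)
  then show ?case by (simp add: list_all2_takeI list_all2_dropI)
qed auto


section \<open>The tree of a cell\<close>

definition code :: "cell \<Rightarrow> dtree" where
  "code c = canon (cell_tree c)"

lemma code_Top [simp]: "code (Top n) = Block (replicate n 1)"
  by (simp add: code_def painted_corolla_def)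

lemma code_Lower [simp]: "code (Lower k c) = bump (k - 1) (code c)"
  by (simp add: code_def canon_pgraft2)

lemma code_Upper: "leaves f = length cs \<Longrightarrow> code (Upper f cs) = graft f (map code cs)"
  unfolding code_def by (simp add: canon_paint o_def)

lemma painted_cell_tree: "is_cell c \<Longrightarrow> painted (cell_tree c)"
  by (induction c)
    (auto simp: painted_corolla_def assoc_faces_def painted_paint painted_pgraft2)

lemma proper_code: "is_cell c \<Longrightarrow> proper (code c)"
  unfolding code_def by (intro proper_canon painted_cell_tree)

lemma dsize_code: "is_cell c \<Longrightarrow> dsize (code c) = arity c"
proof (induction c)
  case (Upper f cs)
  then have "dsize (code (Upper f cs)) = sum_list (map (dsize \<circ> code) cs)"
    by (simp add: code_Upper assoc_faces_def dsize_graft)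
  also have "\<dots> = sum_list (map arity cs)"
    using Upper by (intro arg_cong[where f = sum_list] map_cong) auto
  finally show ?case by simp
qed (auto simp: sum_list_replicate dsize_bump)

lemma ddim_code: "is_cell c \<Longrightarrow> ddim (code c) = cell_dim c"
proof (induction c)
  case (Upper f cs)
  then have "ddim (code (Upper f cs)) = assoc_dim f + sum_list (map (ddim \<circ> code) cs)"
    by (simp add: code_Upper assoc_faces_def ddim_graft)
  also have "map (ddim \<circ> code) cs = map cell_dim cs"
    using Upper by (intro map_cong) auto
  finally show ?case by simp
qed (auto simp: ddim_bump)

lemma domain_equivalent_code:
  "is_cell c \<Longrightarrow> is_cell d \<Longrightarrow> domain_equivalent (cell_tree c) (cell_tree d) \<longleftrightarrow> code c = code d"
  by (simp add: domain_equivalent_iff painted_cell_tree code_def)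

text \<open>The relation inserted into \<open>facet_le\<close> is the one that induction over
  \<open>cell_le\<close> provides for the factors. In an upper facet the factors are raised first,
  with \<open>f\<close> fixed, and then \<open>f\<close> is collapsed to \<open>g\<close>.\<close>

lemma facet_le_code:
  assumes "facet_le (\<lambda>c d. arity c = arity d \<and> dle (code c) (code d)) c d"
    and "is_cell c" "is_cell d"
  shows "arity c = arity d \<and> dle (code c) (code d)"
  using assms
proof cases
  case (1 f g cs ds)
  have "map arity cs = map arity ds"
    using 1(4) by (auto simp: list_all2_conv_all_nth intro: nth_equalityI)
  moreover have "list_all2 dle (map code cs) (map code ds)"
    using 1(4) by (auto simp: list_all2_conv_all_nth)
  moreover have "leaves f = length cs" "leaves g = length ds"
    using assms(2,3) 1 by (auto simp: assoc_faces_def)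
  moreover have "length cs = length ds"
    using 1(4) by (rule list_all2_lengthD)
  ultimately have "arity c = arity d" "dle (graft f (map code cs)) (graft f (map code ds))"
    "dle (graft f (map code ds)) (graft g (map code ds))"
    using 1(3) by (auto simp: 1(1,2) intro!: graft_mono graft_refines)
  with \<open>leaves f = _\<close> \<open>leaves g = _\<close> show ?thesis
    unfolding 1(1,2) by (metis code_Upper rtranclp_trans)
next
  case (2 c' d' k)
  with assms(2) show ?thesis by (auto intro!: dle_bump simp: dsize_code)
qed

text \<open>Each closure rule respects the order on trees: \<open>cone\<close> because the corolla
  is greatest, \<open>facet\<close> because grafting is monotone, \<open>glue\<close> because the
  matched cells have domain equivalent trees.\<close>

lemma cell_le_code:
  "cell_le c d \<Longrightarrow> is_cell c \<and> is_cell d \<and> arity c = arity d \<and> dle (code c) (code d)"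
proof (induction rule: cell_le.induct)
  case (cone c)
  have "1 \<le> arity c" "dle (code c) (Block (replicate (arity c) 1))"
    using cone dsize_pos dle_top proper_code dsize_code by metis+
  with cone show ?case by simp
next
  case (facet c d)
  have "facet_le (\<lambda>c d. arity c = arity d \<and> dle (code c) (code d)) c d"
    by (rule facet_le_mono[rule_format, OF _ facet(3)]) blast
  with facet_le_code facet(1,2) show ?case by blast
next
  case (glue s s' c d)
  then have "code c = code d" by (simp add: domain_equivalent_code)
  with glue dsize_code show ?case by (metis rtranclp.rtrancl_refl)
qed auto


section \<open>Cells with equal trees coincide\<close>

abbreviation cell_eqv :: "cell \<Rightarrow> cell \<Rightarrow> bool" where
  "cell_eqv c d \<equiv> cell_le c d \<and> cell_le d c"

lemma cell_eqv_trans: "cell_eqv c d \<Longrightarrow> cell_eqv d e \<Longrightarrow> cell_eqv c e"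
  using cell_le.trans by blast

lemma cell_le_refl: "is_cell c \<Longrightarrow> cell_le c c"
proof (induction c)
  case (Top n)
  then show ?case using cell_le.cone[of "Top n"] by simp
next
  case (Upper f cs)
  then have "list_all2 cell_le cs cs"
    by (auto simp: list_all2_conv_all_nth)
  with Upper.prems show ?case
    by (intro cell_le.facet facet_le.intros) auto
next
  case (Lower k c)
  then show ?case by (auto intro: cell_le.facet facet_le.intros(2))
qed

lemma cell_le_is_cell: "cell_le c d \<Longrightarrow> is_cell c \<and> is_cell d \<and> arity c = arity d"
  using cell_le_code by blast

lemma arity_pos: "is_cell c \<Longrightarrow> 1 \<le> arity c"
  using dsize_code dsize_pos proper_code by metis

lemma cell_le_Upper:
  assumes "is_cell (Upper f cs)" "is_cell (Upper g ds)" "refines f g" "list_all2 cell_le cs ds"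
  shows "cell_le (Upper f cs) (Upper g ds)"
  using assms by (intro cell_le.facet facet_le.intros) auto

lemma cell_le_Lower:
  assumes "1 \<le> k" "k \<le> arity c" "cell_le c d"
  shows "cell_le (Lower k c) (Lower k d)"
  using assms cell_le_is_cell[of c d] by (auto intro: cell_le.facet facet_le.intros(2))

lemma cell_eqv_Lower:
  assumes "1 \<le> k" "k \<le> arity c" "cell_eqv c d"
  shows "cell_eqv (Lower k c) (Lower k d)"
  using assms cell_le_Lower cell_le_is_cell[of c d] by simp

lemma cell_eqv_Upper:
  assumes "is_cell (Upper f cs)" "list_all2 cell_eqv cs ds"
  shows "is_cell (Upper f ds) \<and> cell_eqv (Upper f cs) (Upper f ds)"
proof -
  have "length cs = length ds"
    using assms(2) by (rule list_all2_lengthD)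
  moreover have "\<forall>d \<in> set ds. is_cell d"
    using assms(2) cell_le_is_cell by (fastforce simp: list_all2_conv_all_nth in_set_conv_nth)
  ultimately have "is_cell (Upper f ds)" using assms(1) by simp
  moreover have "list_all2 cell_le cs ds" "list_all2 cell_le ds cs"
    using assms(2) by (auto simp: list_all2_conv_all_nth)
  ultimately show ?thesis using assms(1) by (simp add: cell_le_Upper)
qed

lemma cell_eqv_Upper_context:
  assumes "is_cell (Upper f (as @ c # bs))" "cell_eqv c d"
  shows "is_cell (Upper f (as @ d # bs)) \<and> cell_eqv (Upper f (as @ c # bs)) (Upper f (as @ d # bs))"
proof (rule cell_eqv_Upper[OF assms(1)])
  have "list_all2 cell_eqv as as" "list_all2 cell_eqv bs bs"
    using assms(1) by (auto simp: list_all2_conv_all_nth cell_le_refl)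
  with assms(2) show "list_all2 cell_eqv (as @ c # bs) (as @ d # bs)"
    by (intro list_all2_appendI) auto
qed

abbreviation tops :: "cell list \<Rightarrow> cell list" where
  "tops \<equiv> map (\<lambda>c. Top (arity c))"

lemma list_all2_tops: "\<forall>c \<in> set cs. is_cell c \<Longrightarrow> list_all2 cell_le cs (tops cs)"
  by (auto simp: list_all2_conv_all_nth intro: cell_le.cone)

lemma is_cell_Upper_iff:
  "is_cell (Upper f cs) \<longleftrightarrow>
    2 \<le> length cs \<and> unpainted f \<and> leaves f = length cs \<and> (\<forall>c \<in> set cs. is_cell c)"
  by (auto simp: assoc_faces_def)

text \<open>Arities of cells are positive, so this form without truncation lets the dimension counts
  for sub-facets go through.\<close>

lemma sum_arity_tops:
  "\<forall>c \<in> set cs. is_cell c \<Longrightarrow>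
    sum_list (map arity cs) = sum_list (map (\<lambda>c. arity c - 1) cs) + length cs"
proof (induction cs)
  case (Cons c cs)
  then show ?case using arity_pos[of c] by simp
qed simp

section \<open>The three exchanges between facets\<close>

lemma cell_eqv_glue:
  assumes "is_subfacet s" "is_subfacet s'" "facet_of s \<noteq> facet_of s'" "code s = code s'"
    and "is_cell c" "is_cell d" "facet_le cell_le c s" "facet_le cell_le d s'" "code c = code d"
  shows "cell_eqv c d"
proof -
  have "is_cell s" "is_cell s'"
    using assms(1,2) by (auto simp: is_subfacet_def)
  with assms show ?thesis
    using cell_le.glue[of s s' c d] cell_le.glue[of s' s d c] domain_equivalent_code by metis
qed

text \<open>Associativity of grafting: the painted subtree \<open>UNode ys\<close> can be cut off
  and grafted back together with the trees it carries.\<close>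

lemma code_Upper_nested:
  assumes "length as = sum_list (map leaves xs)" "length bs = sum_list (map leaves ys)"
    "length cs = sum_list (map leaves zs)"
  shows "code (Upper (UNode (xs @ UNode ys # zs)) (as @ bs @ cs)) =
    code (Upper (UNode (xs @ Leaf # zs)) (as @ Upper (UNode ys) bs # cs))"
  using assms by (simp add: code_Upper graft_list_append)

lemma is_cell_nested:
  assumes "is_cell (Upper (UNode (xs @ UNode ys # zs)) (as @ bs @ cs))"
    and len: "length as = sum_list (map leaves xs)" "length bs = sum_list (map leaves ys)"
      "length cs = sum_list (map leaves zs)"
  shows "is_cell (Upper (UNode ys) bs)"
    "is_cell (Upper (UNode (xs @ Leaf # zs)) (as @ Upper (UNode ys) bs # cs))"
    "2 \<le> length bs" "1 \<le> length as + length cs"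
proof -
  have f: "unpainted (UNode (xs @ UNode ys # zs))"
    and cells: "\<forall>c \<in> set as \<union> set bs \<union> set cs. is_cell c"
    using assms(1) unfolding is_cell_Upper_iff by auto
  have ge: "length xs \<le> length as" "length ys \<le> length bs" "length zs \<le> length cs"
    using f len by (auto intro!: leaves_ge_length)
  show bs: "2 \<le> length bs" and ac: "1 \<le> length as + length cs"
    using f ge by auto
  show ys: "is_cell (Upper (UNode ys) bs)"
    unfolding is_cell_Upper_iff using f bs len cells by simp
  show "is_cell (Upper (UNode (xs @ Leaf # zs)) (as @ Upper (UNode ys) bs # cs))"
    unfolding is_cell_Upper_iff using f ac len cells ys by (simp add: ball_Un)
qed

text \<open>The exchange between two upper facets: the painted subtree \<open>UNode ys\<close> is
  read as part of the associahedron factor, or as part of an upper cell of a composihedron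
  factor.\<close>

lemma cell_eqv_Upper_nested:
  assumes cell: "is_cell (Upper (UNode (xs @ UNode ys # zs)) (as @ bs @ cs))"
    and len: "length as = sum_list (map leaves xs)" "length bs = sum_list (map leaves ys)"
      "length cs = sum_list (map leaves zs)"
  shows "cell_eqv (Upper (UNode (xs @ UNode ys # zs)) (as @ bs @ cs))
    (Upper (UNode (xs @ Leaf # zs)) (as @ Upper (UNode ys) bs # cs))"
proof -
  let ?k = "length as" and ?l = "length bs" and ?m = "length cs"
  let ?Lk = "replicate ?k Leaf" and ?Lm = "replicate ?m Leaf"
  \<comment> \<open>\<open>?s\<close> lies on the facet of K(k + l + m) given by the tree with one
    internal edge. \<open>?s'\<close> lies on the upper facet with l branches of the middle factor.
    All other factors are full.\<close>
  let ?s = "Upper (UNode (?Lk @ corolla ?l # ?Lm)) (tops as @ tops bs @ tops cs)"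
  let ?s' = "Upper (corolla (?k + 1 + ?m)) (tops as @ Upper (corolla ?l) (tops bs) # tops cs)"
  note nested = is_cell_nested[OF assms]
  have cells: "\<forall>c \<in> set as. is_cell c" "\<forall>c \<in> set bs. is_cell c" "\<forall>c \<in> set cs. is_cell c"
    using cell by auto
  then have pos: "\<forall>c \<in> set as \<union> set bs \<union> set cs. 1 \<le> arity c"
    using arity_pos by blast
  then have ts: "\<forall>c \<in> set (tops as) \<union> set (tops bs) \<union> set (tops cs). is_cell c"
    by auto
  have u: "is_cell (Upper (corolla ?l) (tops bs))"
    unfolding is_cell_Upper_iff using nested(3) ts by (simp add: unpainted_corolla)
  have s: "is_cell ?s"
    unfolding is_cell_Upper_iff using nested(3,4) ts
    by (simp add: unpainted_corolla sum_list_replicate ball_Un)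
  have s': "is_cell ?s'"
    unfolding is_cell_Upper_iff using nested(4) ts u by (simp add: unpainted_corolla ball_Un)
  have dims: "assoc_dim (corolla n) = n - 2" for n
    by (simp add: assoc_dim_def)
  have "is_subfacet ?s"
    using s nested(3,4)
    by (simp add: is_subfacet_def dims o_def assoc_dim_def sum_list_replicate)
  moreover have "is_subfacet ?s'"
    using s' nested(3,4) sum_arity_tops[OF cells(2)]
    by (simp add: is_subfacet_def dims o_def)
  \<comment> \<open>The two facets have k + l + m and k + 1 + m factors, and l is at least
    2.\<close>
  moreover have "facet_of ?s \<noteq> facet_of ?s'"
    using nested(3) by simp
  moreover have "code ?s = code ?s'"
    using code_Upper_nested[of "tops as" ?Lk "tops bs" "replicate ?l Leaf" "tops cs" ?Lm]
    by (simp add: corolla_def sum_list_replicate replicate_app_Cons_same flip: replicate_add)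
  moreover have "facet_le cell_le (Upper (UNode (xs @ UNode ys # zs)) (as @ bs @ cs)) ?s"
  proof (rule facet_le.intros)
    have "refines (UNode (xs @ UNode ys # zs)) (UNode (xs @ corolla ?l # zs))"
      using refines_corolla[of ys] len by (intro refines_context) simp
    also have "refines \<dots> (UNode (?Lk @ corolla ?l # zs))"
      using refines_flatten_list[of "[]" xs] len by simp
    also have "refines \<dots> (UNode (?Lk @ corolla ?l # ?Lm))"
      using refines_flatten_list[of "?Lk @ [corolla ?l]" zs "[]"] len by simp
    finally show "refines (UNode (xs @ UNode ys # zs)) (UNode (?Lk @ corolla ?l # ?Lm))" .
    show "list_all2 cell_le (as @ bs @ cs) (tops as @ tops bs @ tops cs)"
      using cells by (intro list_all2_appendI list_all2_tops)
  qed
  moreover have "facet_le cell_le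
    (Upper (UNode (xs @ Leaf # zs)) (as @ Upper (UNode ys) bs # cs)) ?s'"
  proof (rule facet_le.intros)
    show "refines (UNode (xs @ Leaf # zs)) (corolla (?k + 1 + ?m))"
      using refines_corolla[of "xs @ Leaf # zs"] len by simp
    have "cell_le (Upper (UNode ys) bs) (Upper (corolla ?l) (tops bs))"
      using nested(1) u refines_corolla[of ys] len list_all2_tops[OF cells(2)]
      by (intro cell_le_Upper) auto
    then show "list_all2 cell_le (as @ Upper (UNode ys) bs # cs)
      (tops as @ Upper (corolla ?l) (tops bs) # tops cs)"
      using cells by (intro list_all2_appendI list_all2_Cons[THEN iffD2] conjI list_all2_tops)
  qed
  ultimately show ?thesis
    using cell_eqv_glue[of ?s ?s'] cell nested(2) code_Upper_nested[OF len] by blast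
qed

lemma update_at_take:
  "take n (update_at sz g j xs) =
    (if j < sum_list (map sz (take n xs)) then update_at sz g j (take n xs) else take n xs)"
proof (cases "n \<le> length xs")
  case True
  then show ?thesis
    using update_at_append[of sz g j "take n xs" "drop n xs"] by simp
next
  case False
  have "update_at sz g j xs = xs" if "\<not> j < sum_list (map sz xs)"
    using that by (induction xs arbitrary: j) auto
  with False show ?thesis by simp
qed

lemma update_at_drop:
  "drop n (update_at sz g j xs) =
    (if j < sum_list (map sz (take n xs)) then drop n xs
     else update_at sz g (j - sum_list (map sz (take n xs))) (drop n xs))"
proof (cases "n \<le> length xs")
  case True
  then show ?thesis
    using update_at_append[of sz g j "take n xs" "drop n xs"] by simp
qed simp

lemma bump_graft:
  "leaves f = length ds \<Longrightarrow> j < sum_list (map dsize ds) \<Longrightarrow>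
    bump j (graft f ds) = graft f (update_at dsize bump j ds)"
  "sum_list (map leaves fs) = length ds \<Longrightarrow>
    update_at dsize bump j (graft_list fs ds) = graft_list fs (update_at dsize bump j ds)"
proof (induction f ds and fs ds arbitrary: j and j rule: graft_graft_list.induct)
  case (1 ds)
  then show ?case by (cases ds) auto
next
  case (4 t ts ds)
  then show ?case by (simp add: dsize_graft update_at_take update_at_drop)
qed auto

lemma code_Lower_Upper:
  assumes "leaves f = length as + 1 + length bs" "\<forall>c \<in> set (as @ c # bs). is_cell c"
    and "sum_list (map arity as) \<le> j" "j < sum_list (map arity as) + arity c"
  shows "code (Lower (Suc j) (Upper f (as @ c # bs))) =
    code (Upper f (as @ Lower (Suc (j - sum_list (map arity as))) c # bs))"
proof -
  have "map dsize (map code as) = map arity as" "dsize (code c) = arity c"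
    using assms(2) by (auto simp: dsize_code)
  then have sizes: "sum_list (map dsize (map code as)) = sum_list (map arity as)"
    "dsize (code c) = arity c" by presburger+
  with assms(1,3,4) have "bump j (graft f (map code (as @ c # bs))) =
    graft f (update_at dsize bump j (map code (as @ c # bs)))"
    by (intro bump_graft) auto
  also have "update_at dsize bump j (map code (as @ c # bs)) =
    map code as @ bump (j - sum_list (map arity as)) (code c) # map code bs"
    using assms(3,4) less_diff_conv2[OF assms(3), of "arity c"]
    by (simp only: map_append list.map update_at_append sizes) (simp add: sizes add.commute)
  finally show ?thesis
    using assms(1) by (simp add: code_Upper)
qed

text \<open>The exchange between a lower and an upper facet: leaf \<open>j\<close> belongs to the
  factor \<open>c\<close>, so the pair may be grafted to \<open>c\<close> beforehand.
  \<open>Lower\<close> counts leaves from 1 and \<open>j\<close> from 0, hence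
  \<open>Suc\<close>.\<close>

lemma cell_eqv_Lower_Upper:
  assumes cell: "is_cell (Upper f (as @ c # bs))"
    and j: "sum_list (map arity as) \<le> j" "j < sum_list (map arity as) + arity c"
  shows "cell_eqv (Lower (Suc j) (Upper f (as @ c # bs)))
    (Upper f (as @ Lower (Suc (j - sum_list (map arity as))) c # bs))"
proof -
  let ?i = "j - sum_list (map arity as)"
  let ?m = "length as + 1 + length bs"
  let ?t = "Upper (corolla ?m) (tops (as @ c # bs))"
  let ?s = "Lower (Suc j) ?t"
  let ?s' = "Upper (corolla ?m) (tops as @ Lower (Suc ?i) (Top (arity c)) # tops bs)"
  have f: "unpainted f" "leaves f = ?m" "2 \<le> ?m" "\<forall>c \<in> set (as @ c # bs). is_cell c"
    using cell unfolding is_cell_Upper_iff by auto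
  \<comment> \<open>As \<open>f\<close> has at least two leaves it is a node; the case expression
    merely extracts its children.\<close>
  then have ref: "refines f (corolla ?m)"
    using refines_corolla[of "case f of UNode us \<Rightarrow> us"] by (cases f) auto
  have pos: "\<forall>c \<in> set (as @ c # bs). 1 \<le> arity c"
    using f(4) arity_pos by blast
  have t: "is_cell ?t" and s': "is_cell ?s'"
    using f pos j unfolding is_cell_Upper_iff by (auto simp: assoc_faces_def unpainted_corolla)
  then have s: "is_cell ?s"
    using j by (simp add: o_def)
  have dims: "assoc_dim (corolla n) = n - 2" for n
    by (simp add: assoc_dim_def)
  have "is_subfacet ?s"
    using s f(3) sum_arity_tops[OF f(4)] pos by (auto simp: is_subfacet_def dims o_def)
  moreover have "is_subfacet ?s'"
    using s' f(3) pos by (auto simp: is_subfacet_def dims o_def)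
  moreover have "\<forall>x \<in> set (tops as @ Top (arity c) # tops bs). is_cell x"
    using pos by auto
  then have "code ?s = code ?s'"
    using code_Lower_Upper[of "corolla ?m" "tops as" "tops bs" "Top (arity c)" j] j
    by (simp add: o_def)
  moreover have cd: "is_cell (Lower (Suc j) (Upper f (as @ c # bs)))"
    "is_cell (Upper f (as @ Lower (Suc ?i) c # bs))"
    using cell j by (auto simp: assoc_faces_def)
  moreover have "facet_le cell_le (Lower (Suc j) (Upper f (as @ c # bs))) ?s"
    using cell t ref f(4) by (intro facet_le.intros cell_le_Upper list_all2_tops)
  moreover have "facet_le cell_le (Upper f (as @ Lower (Suc ?i) c # bs)) ?s'"
  proof (intro facet_le.intros ref list_all2_appendI list_all2_Cons[THEN iffD2] conjI list_all2_tops)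
    show "cell_le (Lower (Suc ?i) c) (Lower (Suc ?i) (Top (arity c)))"
      using f(4) j by (intro cell_le_Lower cell_le.cone) auto
  qed (use f(4) in auto)
  ultimately show ?thesis
    using cell_eqv_glue[of ?s ?s'] code_Lower_Upper[OF f(2,4) j] by auto
qed

text \<open>The exchange between two lower facets, which are distinct as \<open>i < j\<close>. For
  \<open>j = i + 1\<close> it identifies the two binary trees with three leaves above the same leaf
  of \<open>e\<close>.\<close>

lemma cell_eqv_Lower_Lower:
  assumes "is_cell e" "i < j" "j \<le> arity e"
  shows "cell_eqv (Lower (Suc j) (Lower (Suc i) e)) (Lower (Suc i) (Lower j e))"
proof -
  let ?T = "Top (arity e)"
  let ?s = "Lower (Suc j) (Lower (Suc i) ?T)" and ?s' = "Lower (Suc i) (Lower j ?T)"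
  have pos: "1 \<le> arity e" using assms(1) by (rule arity_pos)
  with assms have "is_subfacet ?s" "is_subfacet ?s'" "facet_of ?s \<noteq> facet_of ?s'"
    by (auto simp: is_subfacet_def)
  moreover have "code (Lower (Suc j) (Lower (Suc i) c)) = code (Lower (Suc i) (Lower j c))"
    if "is_cell c" "arity c = arity e" for c
    using assms(2,3) that bump_bump[of i j "code c"] by (simp add: dsize_code)
  from this[of e] this[of ?T] have "code ?s = code ?s'"
    "code (Lower (Suc j) (Lower (Suc i) e)) = code (Lower (Suc i) (Lower j e))"
    using assms(1) pos by auto
  moreover have "is_cell (Lower (Suc j) (Lower (Suc i) e))" "is_cell (Lower (Suc i) (Lower j e))"
    using assms by auto
  moreover have "facet_le cell_le (Lower (Suc j) (Lower (Suc i) e)) ?s"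
    "facet_le cell_le (Lower (Suc i) (Lower j e)) ?s'"
    using assms by (auto intro!: facet_le.intros cell_le_Lower cell_le.cone)
  ultimately show ?thesis
    using cell_eqv_glue[of ?s ?s'] by blast
qed


section \<open>A name for every tree\<close>

text \<open>Normal form for \<open>Block (replicate p 1 @ ns)\<close>: the outermost
  \<open>Lower\<close> enlarges the leftmost entry above 1 at its first leaf, which is leaf p
  counted from 0 because only ones precede. An entry 0 would be read as 1; positivity of the entries
  excludes it.\<close>

function low :: "nat \<Rightarrow> nat list \<Rightarrow> cell" where
  "low p [] = Top p"
| "low p (n # ns) = (if n \<le> 1 then low (Suc p) ns else Lower (Suc p) (low p ((n - 1) # ns)))"
  by pat_completeness auto
termination by (relation "measure (\<lambda>(p, ns). sum_list ns + length ns)") auto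

fun name :: "dtree \<Rightarrow> cell" where
  "name (Block ns) = low 0 ns"
| "name (Branch ts) = Upper (corolla (length ts)) (map name ts)"

lemma low_replicate: "low p (replicate q 1 @ ns) = low (p + q) ns"
  by (induction q arbitrary: p) auto

lemma name_ones [simp]: "name (Block (replicate n 1)) = Top n"
  using low_replicate[of 0 n "[]"] by simp

lemma low_Suc:
  assumes "1 \<le> m"
  shows "low 0 (replicate p 1 @ Suc m # ns) = Lower (Suc p) (low 0 (replicate p 1 @ m # ns))"
  using assms unfolding low_replicate by simp

lemma incr_at: "1 \<le> m \<Longrightarrow> incr (sum_list xs) (xs @ m # zs) = xs @ Suc m # zs"
  by (simp add: update_at_append)

lemma low_spec:
  "\<forall>n \<in> set ns. 1 \<le> n \<Longrightarrow> 1 \<le> p + length ns \<Longrightarrow>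
    is_cell (low p ns) \<and> code (low p ns) = Block (replicate p 1 @ ns)"
proof (induction p ns rule: low.induct)
  case (2 p n ns)
  show ?case
  proof (cases "n \<le> 1")
    case True
    then have "n = 1" using 2(3) by simp
    with 2 show ?thesis by (simp add: replicate_app_Cons_same)
  next
    case False
    let ?c = "low p ((n - 1) # ns)"
    have pos: "\<forall>k \<in> set ((n - 1) # ns). 1 \<le> k" using 2(3) False by auto
    have c: "is_cell ?c" "code ?c = Block (replicate p 1 @ (n - 1) # ns)"
      using 2(2)[OF False] 2(4) pos by simp_all
    moreover from this have "Suc p \<le> arity ?c"
      using False dsize_code[of ?c] by (simp add: sum_list_replicate)
    moreover have "incr p (replicate p 1 @ (n - 1) # ns) = replicate p 1 @ n # ns"
      using incr_at[of "n - 1" "replicate p 1" ns] False by (simp add: sum_list_replicate)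
    ultimately show ?thesis using False by simp
  qed
qed simp

lemma name_spec: "proper t \<Longrightarrow> is_cell (name t) \<and> code (name t) = t"
proof (induction t)
  case (Block ns)
  then show ?case using low_spec[of ns 0] by (cases ns) auto
next
  case (Branch ts)
  then have "map (code \<circ> name) ts = ts" "\<forall>t \<in> set ts. is_cell (name t)"
    by (auto intro: map_idI)
  with Branch.prems show ?case
    using graft_corolla[of ts] by (simp add: code_Upper assoc_faces_def unpainted_corolla)
qed

lemma arity_name: "proper t \<Longrightarrow> arity (name t) = dsize t"
  using name_spec dsize_code by metis

text \<open>Decides whether the normal form is a \<open>Top\<close> or has an outermost
  \<open>Lower\<close>, and locates the entry that this \<open>Lower\<close> enlarges.\<close>

lemma ones_or_large:
  assumes "\<forall>n \<in> set ns. 1 \<le> n"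
  obtains "ns = replicate (length ns) 1"
    | p m zs where "1 \<le> m" "ns = replicate p 1 @ Suc m # zs"
  using assms
proof (induction ns arbitrary: thesis)
  case (Cons n ns)
  show ?case
  proof (cases "n = 1")
    case True
    show ?thesis
    proof (rule Cons.IH)
      assume "ns = replicate (length ns) 1"
      then show ?thesis using True Cons.prems(1) by simp
    next
      fix p m zs assume "1 \<le> m" "ns = replicate p (1::nat) @ Suc m # zs"
      then show ?thesis using True Cons.prems(2)[of m "Suc p" zs] by simp
    qed (use Cons.prems(3) in auto)
  next
    case False
    with Cons.prems(3) have "1 \<le> n - 1" by auto
    then show ?thesis using Cons.prems(2)[of "n - 1" 0 ns] by simp
  qed
qed simp

lemma replicate_split: "j < n \<Longrightarrow> replicate n x = replicate j x @ x # replicate (n - Suc j) x"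
  using replicate_add[of j "Suc (n - Suc j)" x] by simp

text \<open>A new \<open>Lower\<close> either already stands where the normal form wants it, or is
  exchanged with the outermost one and handled below it, where the entries have a smaller
  sum.\<close>

lemma cell_eqv_low:
  assumes "\<forall>n \<in> set ns. 1 \<le> n" "j < sum_list ns"
  shows "cell_eqv (Lower (Suc j) (low 0 ns)) (low 0 (incr j ns))"
  using assms
proof (induction "sum_list ns" arbitrary: ns j rule: less_induct)
  case less
  have "is_cell (low 0 ns)" "arity (low 0 ns) = sum_list ns"
    using low_spec[of ns 0] less.prems dsize_code[of "low 0 ns"] by (cases ns; simp)+
  then have refl: "cell_eqv (Lower (Suc j) (low 0 ns)) (Lower (Suc j) (low 0 ns))"
    using less.prems(2) by (simp add: cell_le_refl)
  \<comment> \<open>Leaf \<open>j\<close> is the first leaf of the entry \<open>m\<close> and only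
    ones precede it, so the new \<open>Lower\<close> is itself the outermost layer of the normal
    form.\<close>
  have direct: ?case if "1 \<le> m" "ns = replicate j 1 @ m # zs" for m zs
  proof -
    have "incr j ns = replicate j 1 @ Suc m # zs"
      using incr_at[of m "replicate j 1" zs] that by (simp add: sum_list_replicate)
    with that refl show ?thesis by (simp only: low_Suc)
  qed
  from less.prems(1) show ?case
  proof (cases rule: ones_or_large)
    case 1
    then have "sum_list ns = length ns"
      by (metis sum_list_replicate mult.right_neutral of_nat_id)
    with less.prems(2) have "j < length ns" by simp
    show ?thesis
      by (rule direct[OF order_refl HOL.trans[OF 1 replicate_split]]) fact
  next
    case (2 p m zs)
    consider "j < p" | "j = p" | "p < j" by linarith
    then show ?thesis
    proof cases
      case 1
      from replicate_split[OF this, of "1 :: nat"] 2 show ?thesis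
        using direct[of 1 "replicate (p - Suc j) 1 @ Suc m # zs"] by simp
    next
      case j: 2
      with 2 show ?thesis using direct[of "Suc m" zs] by simp
    next
      case 3
      let ?ns = "replicate p 1 @ m # zs"
      let ?e = "low 0 ?ns"
      have pos: "\<forall>n \<in> set ?ns. 1 \<le> n" and sum: "sum_list ns = Suc (sum_list ?ns)"
        using 2 less.prems(1) by auto
      have e: "is_cell ?e" "arity ?e = sum_list ?ns"
        using low_spec[OF pos, of 0] dsize_code[of ?e] by auto
      \<comment> \<open>The layer at \<open>p\<close> moves outside. Without the leaf that it adds,
        leaf \<open>j\<close> has number \<open>j - 1\<close>, which \<open>Lower\<close> writes as
        \<open>j\<close>.\<close>
      have swap: "cell_eqv (Lower (Suc j) (Lower (Suc p) ?e)) (Lower (Suc p) (Lower j ?e))"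
        using cell_eqv_Lower_Lower[OF e(1), of p j] 3 less.prems(2) sum e(2) by simp
      have "cell_eqv (Lower j ?e) (low 0 (incr (j - 1) ?ns))"
        using less.hyps[OF _ pos, of "j - 1"] sum 3 less.prems(2) by simp
      then have IH: "cell_eqv (Lower (Suc p) (Lower j ?e)) (Lower (Suc p) (low 0 (incr (j - 1) ?ns)))"
        using 2(1) e(2) by (intro cell_eqv_Lower) (auto simp: sum_list_replicate)
      have "Lower (Suc p) (low 0 (incr (j - 1) ?ns)) = low 0 (incr j ns)"
      \<comment> \<open>Leaf \<open>j\<close> lies in the entry at position \<open>p\<close> or in a
        later one; in both cases the entry at \<open>p\<close> still carries the outermost
        layer.\<close>
      proof (cases "j - p < Suc m")
        case True
        then have "incr (j - 1) ?ns = replicate p 1 @ Suc m # zs"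
          "incr j ns = replicate p 1 @ Suc (Suc m) # zs"
          using 2 3 by (auto simp: update_at_append sum_list_replicate)
        then show ?thesis using 2(1) by (simp only: low_Suc)
      next
        case False
        then have "incr (j - 1) ?ns = replicate p 1 @ m # incr (j - p - Suc m) zs"
          "incr j ns = replicate p 1 @ Suc m # incr (j - p - Suc m) zs"
          using 2 3 by (auto simp: update_at_append sum_list_replicate)
        then show ?thesis using 2(1) by (simp only: low_Suc)
      qed
      moreover have "low 0 ns = Lower (Suc p) ?e"
        using 2 by (simp only: low_Suc)
      ultimately show ?thesis
        using cell_eqv_trans[OF swap IH] by (simp only:)
    qed
  qed
qed

text \<open>In a \<open>Branch\<close> the pair is pushed into the child that contains leaf
  \<open>j\<close>, and the induction hypothesis normalises that child.\<close>

lemma cell_eqv_bump: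
  "proper t \<Longrightarrow> j < dsize t \<Longrightarrow> cell_eqv (Lower (Suc j) (name t)) (name (bump j t))"
proof (induction t arbitrary: j)
  case (Block ns)
  then show ?case using cell_eqv_low[of ns j] by simp
next
  case (Branch ts)
  then obtain as x bs where ts: "ts = as @ x # bs" and j: "sum_list (map dsize as) \<le> j"
    "j < sum_list (map dsize as) + dsize x"
    by (auto elim: position_split)
  let ?i = "j - sum_list (map dsize as)" and ?f = "corolla (length ts)"
  have proper: "\<forall>t \<in> set ts. proper t" using Branch.prems(1) by simp
  have "map arity (map name as) = map dsize as"
    using proper ts by (auto simp: arity_name)
  then have as: "sum_list (map arity (map name as)) = sum_list (map dsize as)"
    by (rule arg_cong)
  have x: "arity (name x) = dsize x"
    using proper ts by (simp add: arity_name)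
  have "is_cell (name (Branch ts))"
    using Branch.prems(1) name_spec by blast
  then have cell: "is_cell (Upper ?f (map name as @ name x # map name bs))"
    using ts by simp
  have *: "cell_eqv (Lower (Suc j) (Upper ?f (map name as @ name x # map name bs)))
    (Upper ?f (map name as @ Lower (Suc ?i) (name x) # map name bs))"
    using cell_eqv_Lower_Upper[OF cell, of j] j unfolding as x by simp
  have i: "?i < dsize x" using j by linarith
  have "cell_eqv (Lower (Suc ?i) (name x)) (name (bump ?i x))"
    using Branch.IH[of x ?i] proper ts i by simp
  moreover have "is_cell (Upper ?f (map name as @ Lower (Suc ?i) (name x) # map name bs))"
    using * cell_le_is_cell by blast
  ultimately have "cell_eqv (Upper ?f (map name as @ Lower (Suc ?i) (name x) # map name bs))
    (Upper ?f (map name as @ name (bump ?i x) # map name bs))"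
    using cell_eqv_Upper_context by blast
  from cell_eqv_trans[OF * this] show ?case
    using ts j i by (simp add: update_at_append)
qed

text \<open>The normal form has only corollas as associahedron factors. An inner node of
  \<open>f\<close> is cut off into a factor of its own; the branch cut off and the remaining tree
  both have fewer nodes, so the hypothesis is used twice.\<close>

lemma cell_eqv_graft:
  assumes "unpainted f" "leaves f = length ds" "2 \<le> length ds" "\<forall>d \<in> set ds. proper d"
  shows "cell_eqv (Upper f (map name ds)) (name (graft f ds))"
  using assms
proof (induction "nodes f" arbitrary: f ds rule: less_induct)
  case less
  then obtain fs where f: "f = UNode fs" by (cases f) auto
  have cell: "is_cell (Upper f (map name ds))"
    using less.prems name_spec by (auto simp: assoc_faces_def)
  show ?case
  proof (cases "\<forall>g \<in> set fs. g = Leaf")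
    case True
    then have fs: "fs = replicate (length fs) Leaf"
      by (simp add: replicate_eqI)
    then have "sum_list (map leaves fs) = length fs"
      by (metis leaves_corolla corolla_def leaves.simps(2))
    with fs f less.prems(2) have "f = corolla (length ds)"
      by (simp add: corolla_def)
    with cell show ?thesis by (simp add: graft_corolla cell_le_refl)
  next
    case False
    then obtain g where "g \<in> set fs" "g \<noteq> Leaf" by blast
    then obtain xs ys zs where fs: "fs = xs @ UNode ys # zs"
      by (metis split_list utree.exhaust)
    have "length ds =
      sum_list (map leaves xs) + sum_list (map leaves ys) + sum_list (map leaves zs)"
      using less.prems(2) f fs by simp
    then obtain as bs cs where ds: "ds = as @ bs @ cs"
      and len: "length as = sum_list (map leaves xs)" "length bs = sum_list (map leaves ys)"
        "length cs = sum_list (map leaves zs)"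
      by (rule list_split_lengths)
    have cell': "is_cell (Upper (UNode (xs @ UNode ys # zs))
      (map name as @ map name bs @ map name cs))"
      using cell f fs ds by simp
    let ?g = "UNode (xs @ Leaf # zs)" and ?d = "graft (UNode ys) bs"
    have len': "length (map name as) = sum_list (map leaves xs)"
      "length (map name bs) = sum_list (map leaves ys)"
      "length (map name cs) = sum_list (map leaves zs)"
      using len by auto
    note nested = is_cell_nested[OF cell' len']
    have ys: "unpainted (UNode ys)" "2 \<le> length bs"
      using nested(1,3) by (auto simp: assoc_faces_def)
    have 1: "cell_eqv (Upper f (map name ds))
      (Upper ?g (map name as @ Upper (UNode ys) (map name bs) # map name cs))"
      using cell_eqv_Upper_nested[OF cell' len'] f fs ds by simp
    have "cell_eqv (Upper (UNode ys) (map name bs)) (name ?d)"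
      using less.prems(4) ds ys len f fs by (intro less.hyps) auto
    then have 2: "is_cell (Upper ?g (map name as @ name ?d # map name cs)) \<and>
      cell_eqv (Upper ?g (map name as @ Upper (UNode ys) (map name bs) # map name cs))
        (Upper ?g (map name as @ name ?d # map name cs))"
      using cell_eqv_Upper_context[OF nested(2)] by blast
    have 3: "cell_eqv (Upper ?g (map name (as @ ?d # cs))) (name (graft ?g (as @ ?d # cs)))"
    proof (rule less.hyps)
      show "nodes ?g < nodes f" using f fs by simp
      show "unpainted ?g" "leaves ?g = length (as @ ?d # cs)" "2 \<le> length (as @ ?d # cs)"
        using 2 by (auto simp: assoc_faces_def)
      have "is_cell (Upper (UNode ys) (map name bs))" by (rule nested(1))
      then have "proper (code (Upper (UNode ys) (map name bs)))" by (rule proper_code)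
      moreover have "map (code \<circ> name) bs = bs"
        using less.prems(4) ds name_spec by (auto intro: map_idI)
      ultimately have "proper ?d" using len by (simp add: code_Upper)
      then show "\<forall>d \<in> set (as @ ?d # cs). proper d"
        using less.prems(4) ds by auto
    qed
    have "graft ?g (as @ ?d # cs) = graft f ds"
      using f fs ds len by (simp add: graft_list_append)
    from 3[unfolded this map_append list.map]
    have "cell_eqv (Upper ?g (map name as @ name ?d # map name cs)) (name (graft f ds))" .
    from cell_eqv_trans[OF 1 cell_eqv_trans[OF conjunct2[OF 2] this]] show ?thesis .
  qed
qed

text \<open>Components are normalised first, then the outer layer by \<open>cell_eqv_graft\<close>
  or \<open>cell_eqv_bump\<close>. As the normal form depends on the tree only, all names with the
  same tree are identified.\<close>

lemma cell_eqv_name: "is_cell c \<Longrightarrow> cell_eqv c (name (code c))"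
proof (induction c)
  case (Top n)
  then show ?case using cell_le_refl[OF Top] by (simp only: code_Top name_ones)
next
  case (Upper f cs)
  have "list_all2 cell_eqv cs (map name (map code cs))"
    using Upper by (auto simp: list_all2_conv_all_nth)
  then have "cell_eqv (Upper f cs) (Upper f (map name (map code cs)))"
    using cell_eqv_Upper[OF Upper.prems] by blast
  moreover have "cell_eqv (Upper f (map name (map code cs))) (name (graft f (map code cs)))"
    using Upper.prems proper_code by (intro cell_eqv_graft) (auto simp: assoc_faces_def)
  moreover have "graft f (map code cs) = code (Upper f cs)"
    using Upper.prems by (simp add: code_Upper assoc_faces_def)
  ultimately show ?case using cell_eqv_trans by metis
next
  case (Lower k c)
  then have 1: "cell_eqv (Lower k c) (Lower k (name (code c)))"
    by (intro cell_eqv_Lower) auto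
  have "cell_eqv (Lower (Suc (k - 1)) (name (code c))) (name (bump (k - 1) (code c)))"
    using Lower.prems by (intro cell_eqv_bump) (auto simp: proper_code dsize_code)
  moreover have "Suc (k - 1) = k" using Lower.prems by simp
  ultimately have "cell_eqv (Lower k (name (code c))) (name (bump (k - 1) (code c)))"
    by (simp only:)
  from cell_eqv_trans[OF 1 this] show ?case by (simp only: code_Lower)
qed

lemma cell_eqv_if_code: "is_cell c \<Longrightarrow> is_cell d \<Longrightarrow> code c = code d \<Longrightarrow> cell_eqv c d"
  using cell_eqv_name cell_eqv_trans by metis

section \<open>Every step between trees is a closure relation between normal forms\<close>

lemma name_bump_mono:
  assumes "proper s" "proper t" "j < dsize s" "cell_le (name s) (name t)"
  shows "cell_le (name (bump j s)) (name (bump j t))"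
proof -
  have "dsize s = dsize t"
    using assms cell_le_is_cell arity_name by metis
  moreover have "cell_le (Lower (Suc j) (name s)) (Lower (Suc j) (name t))"
    using assms by (intro cell_le_Lower) (auto simp: arity_name)
  ultimately show ?thesis
    using assms(1-3) cell_eqv_bump cell_le.trans by metis
qed

lemma name_le_top: "proper t \<Longrightarrow> cell_le (name t) (name (Block (replicate (dsize t) 1)))"
  using cell_le.cone[of "name t"] name_spec arity_name by (metis name_ones)

text \<open>If an entry on the right exceeds 1, both sides come from a smaller instance by grafting
  at the same leaf, and \<open>name_bump_mono\<close> applies. If all are 1, the right side is the
  corolla and lies above everything.\<close>

lemma name_split:
  assumes "1 \<le> a" "1 \<le> b" "\<forall>n \<in> set xs. 1 \<le> n" "\<forall>n \<in> set zs. 1 \<le> n"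
  shows "cell_le (name (Block (xs @ (a + b) # zs))) (name (Block (xs @ a # b # zs)))"
  using assms
proof (induction "sum_list xs + a + b + sum_list zs" arbitrary: xs a b zs rule: less_induct)
  case less
  have bump: "cell_le (name (Block (xs @ (a + b) # zs))) (name (Block (xs @ a # b # zs)))"
    if "incr j (xs' @ (a' + b') # zs') = xs @ (a + b) # zs"
      "incr j (xs' @ a' # b' # zs') = xs @ a # b # zs"
      "j < sum_list xs' + a' + b' + sum_list zs'"
      "sum_list xs' + a' + b' + sum_list zs' < sum_list xs + a + b + sum_list zs"
      "1 \<le> a'" "1 \<le> b'" "\<forall>n \<in> set xs'. 1 \<le> n" "\<forall>n \<in> set zs'. 1 \<le> n"
    for j xs' a' b' zs'
    using name_bump_mono[OF _ _ _ less.hyps[OF that(4-8)], of j] that by auto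
  consider "2 \<le> a" | "2 \<le> b" | n where "n \<in> set xs" "2 \<le> n" | n where "n \<in> set zs" "2 \<le> n" |
    "a = 1" "b = 1" "\<forall>n \<in> set xs. n = 1" "\<forall>n \<in> set zs. n = 1"
    using less.prems by (metis Suc_1 le_antisym not_less_eq_eq One_nat_def)
  then show ?case
  proof cases
    case 1
    show ?thesis
      by (rule bump[of "sum_list xs" xs "a - 1" b zs])
        (use 1 less.prems in \<open>auto simp: update_at_append\<close>)
  next
    case 2
    show ?thesis
      \<comment> \<open>This is the first leaf of the second part \<open>b - 1\<close>; since
        \<open>b\<close> is at least 2, it also lies in the unsplit entry
        \<open>a + (b - 1)\<close>.\<close>
      by (rule bump[of "sum_list xs + a" xs a "b - 1" zs])
        (use 2 less.prems in \<open>auto simp: update_at_append\<close>)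
  next
    case 3
    then obtain us vs where xs: "xs = us @ n # vs" by (meson split_list)
    show ?thesis
      by (rule bump[of "sum_list us" "us @ (n - 1) # vs" a b zs])
        (use 3 less.prems xs in \<open>auto simp: update_at_append\<close>)
  next
    case 4
    then obtain us vs where zs: "zs = us @ n # vs" by (meson split_list)
    show ?thesis
      by (rule bump[of "sum_list xs + a + b + sum_list us" xs a b "us @ (n - 1) # vs"])
        (use 4 less.prems zs in \<open>auto simp: update_at_append\<close>)
  next
    case 5
    then have "xs @ a # b # zs = replicate (length (xs @ a # b # zs)) 1"
      by (intro replicate_eqI) auto
    moreover have "dsize (Block (xs @ (a + b) # zs)) = length (xs @ a # b # zs)"
      using 5 calculation by (metis dsize.simps(1) sum_list_replicate mult.right_neutral of_nat_id
        sum_list_append sum_list.Cons add.assoc)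
    moreover have "proper (Block (xs @ (a + b) # zs))"
      using less.prems by auto
    ultimately show ?thesis using name_le_top by metis
  qed
qed

text \<open>The same descent as in \<open>name_split\<close>: an entry above 1 is lowered by one in
  both trees, with \<open>?j\<close> its first leaf, until the right side is the corolla.\<close>

lemma name_absorb:
  assumes "2 \<le> length nss" "\<forall>ns \<in> set nss. proper (Block ns)"
  shows "cell_le (name (Branch (map Block nss))) (name (Block (concat nss)))"
  using assms
proof (induction "sum_list (map sum_list nss)" arbitrary: nss rule: less_induct)
  case less
  have proper: "proper (Branch (map Block nss))"
    using less.prems by auto
  show ?case
  proof (cases "\<exists>ns \<in> set nss. \<exists>n \<in> set ns. 2 \<le> n")
    case True
    then obtain us xs n zs vs where nss: "nss = us @ (xs @ n # zs) # vs" and n: "2 \<le> n"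
      by (metis split_list)
    let ?nss = "us @ (xs @ (n - 1) # zs) # vs"
    let ?j = "sum_list (map sum_list us) + sum_list xs"
    have eq: "nss = update_at sum_list incr ?j ?nss"
      using n nss by (simp add: update_at_append)
    have "\<forall>ns \<in> set ?nss. proper (Block ns)" "2 \<le> length ?nss"
      using less.prems nss n by auto
    moreover from this have "proper (Branch (map Block ?nss))" "proper (Block (concat ?nss))"
      by auto
    moreover have "cell_le (name (Branch (map Block ?nss))) (name (Block (concat ?nss)))"
      using calculation nss n by (intro less.hyps) auto
    moreover have "?j < dsize (Branch (map Block ?nss))"
      using n by (simp add: o_def)
    ultimately have "cell_le (name (bump ?j (Branch (map Block ?nss))))
      (name (bump ?j (Block (concat ?nss))))"
      by (intro name_bump_mono)
    then show ?thesis
      unfolding bump.simps incr_concat update_at_map_Block eq[symmetric] .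
  next
    case False
    have "\<forall>ns \<in> set nss. \<forall>n \<in> set ns. n = 1"
      using False less.prems by (auto simp: not_less_eq_eq numeral_2_eq_2 intro: le_antisym)
    then have ones: "concat nss = replicate (length (concat nss)) 1"
      by (intro replicate_eqI) auto
    have "dsize (Branch (map Block nss)) = sum_list (concat nss)"
      by (simp add: o_def sum_list_concat)
    also have "\<dots> = length (concat nss)"
      by (subst ones) (simp add: sum_list_replicate)
    finally show ?thesis
      using ones name_le_top[OF proper] by metis
  qed
qed

lemma name_step: "dstep s t \<Longrightarrow> proper s \<Longrightarrow> cell_le (name s) (name t)"
proof (induction rule: dstep.induct)
  case (split a b xs zs)
  then show ?case by (intro name_split) auto
next
  case (absorb nss)
  then show ?case by (intro name_absorb) auto
next
  case (merge xs ys zs)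
  let ?L = "\<lambda>ts :: dtree list. replicate (length ts) Leaf"
  let ?f = "UNode (?L xs @ UNode (?L ys) # ?L zs)"
  \<comment> \<open>The intermediate name in the facet with all members of \<open>xs\<close>,
    \<open>ys\<close>, \<open>zs\<close> as factors, whose associahedron tree still has the edge to
    be collapsed. Gluing identifies it with the nested normal form; collapsing the edge stays inside
    the facet.\<close>
  let ?c = "Upper ?f (map name xs @ map name ys @ map name zs)"
  have p: "proper (Branch (xs @ ys @ zs))"
    using merge dstep_proper[OF dstep.merge] by blast
  have c: "is_cell ?c"
    using merge name_spec by (auto simp: assoc_faces_def sum_list_replicate)
  have "cell_eqv ?c (Upper (UNode (?L xs @ Leaf # ?L zs))
    (map name xs @ Upper (UNode (?L ys)) (map name ys) # map name zs))"
    using c by (intro cell_eqv_Upper_nested) (auto simp: sum_list_replicate)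
  then have "cell_le (name (Branch (xs @ Branch ys # zs))) ?c"
    by (simp add: corolla_def replicate_app_Cons_same flip: replicate_Suc replicate_add)
  moreover have "cell_le ?c (name (Branch (xs @ ys @ zs)))"
  proof -
    have "collapse1 ?f (UNode (?L xs @ ?L ys @ ?L zs))"
      by (rule collapse1.intros)
    then have "refines ?f (corolla (length (xs @ ys @ zs)))"
      by (simp add: corolla_def collapse1_refines flip: replicate_add)
    moreover have "is_cell (name (Branch (xs @ ys @ zs)))"
      using p name_spec by blast
    moreover have "list_all2 cell_le (map name (xs @ ys @ zs)) (map name (xs @ ys @ zs))"
      using p name_spec by (intro list.rel_refl_strong) (auto intro!: cell_le_refl)
    ultimately show ?thesis using c cell_le_Upper by simp
  qed
  ultimately show ?case by (rule cell_le.trans)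
next
  case (inner s t xs zs)
  have "proper (Branch (xs @ t # zs))"
    using inner dstep_proper[OF dstep.inner] by blast
  then have "is_cell (name (Branch (xs @ s # zs)))" "is_cell (name (Branch (xs @ t # zs)))"
    using inner.prems name_spec by blast+
  moreover have "list_all2 cell_le (map name xs) (map name xs)"
    "list_all2 cell_le (map name zs) (map name zs)" "cell_le (name s) (name t)"
    using inner name_spec by (auto intro!: list.rel_refl_strong cell_le_refl)
  then have "list_all2 cell_le (map name (xs @ s # zs)) (map name (xs @ t # zs))"
    by (simp add: list_all2_appendI)
  ultimately show ?case
    by (simp add: cell_le_Upper del: is_cell.simps)
qed

lemma name_mono: "dle s t \<Longrightarrow> proper s \<Longrightarrow> cell_le (name s) (name t)"
proof (induction rule: rtranclp_induct)
  case base
  then show ?case using name_spec cell_le_refl by blast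
next
  case (step t u)
  then show ?case using name_step dle_proper cell_le.trans by blast
qed

lemma cell_le_iff:
  assumes "is_cell c" "is_cell d"
  shows "cell_le c d \<longleftrightarrow> dle (code c) (code d)"
proof
  assume "dle (code c) (code d)"
  then have "cell_le (name (code c)) (name (code d))"
    using assms by (intro name_mono proper_code)
  then show "cell_le c d"
    using assms cell_eqv_name cell_le.trans by metis
qed (use cell_le_code in blast)


section \<open>The face poset of the composihedron\<close>

definition dtrees :: "nat \<Rightarrow> dtree set" where
  "dtrees n = {t. proper t \<and> dsize t = n}"

text \<open>For \<open>t\<close> in \<open>dtrees n\<close> this is a class of
  \<open>same_cell n\<close>, that is, the cell of CK(n) that belongs to \<open>t\<close>.\<close>

definition names :: "nat \<Rightarrow> dtree \<Rightarrow> cell set" where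
  "names n t = {c. is_cell c \<and> arity c = n \<and> code c = t}"

lemma name_in_names: "t \<in> dtrees n \<Longrightarrow> name t \<in> names n t"
  using name_spec arity_name by (simp add: dtrees_def names_def)

lemma code_in_dtrees: "is_cell c \<Longrightarrow> code c \<in> dtrees (arity c)"
  by (simp add: dtrees_def proper_code dsize_code)

lemma inj_names: "inj_on (names n) (dtrees n)"
proof (rule inj_onI)
  fix s t assume "s \<in> dtrees n" "names n s = names n t"
  then have "name s \<in> names n s" "name s \<in> names n t"
    using name_in_names by auto
  then show "s = t" by (simp add: names_def)
qed

lemma same_cell_iff:
  "(c, d) \<in> same_cell n \<longleftrightarrow>
    is_cell c \<and> is_cell d \<and> arity c = n \<and> arity d = n \<and> code c = code d"
proof
  assume "(c, d) \<in> same_cell n"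
  moreover from this have "dle (code c) (code d)" "dle (code d) (code c)"
    by (auto simp: same_cell_def dest: cell_le_code)
  ultimately show "is_cell c \<and> is_cell d \<and> arity c = n \<and> arity d = n \<and> code c = code d"
    using dle_antisym proper_code by (simp add: same_cell_def)
next
  assume "is_cell c \<and> is_cell d \<and> arity c = n \<and> arity d = n \<and> code c = code d"
  then show "(c, d) \<in> same_cell n"
    using cell_eqv_if_code by (simp add: same_cell_def)
qed

lemma compo_cells_eq: "compo_cells n = names n ` dtrees n"
proof -
  have "same_cell n `` {c} = names n (code c)" if "is_cell c" "arity c = n" for c
    using that by (auto simp: same_cell_iff names_def)
  then have "compo_cells n = (\<lambda>c. names n (code c)) ` {c. is_cell c \<and> arity c = n}"
    by (auto simp: compo_cells_def quotient_def)
  also have "\<dots> = names n ` code ` {c. is_cell c \<and> arity c = n}"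
    by (simp add: image_image)
  also have "code ` {c. is_cell c \<and> arity c = n} = dtrees n"
  proof
    show "code ` {c. is_cell c \<and> arity c = n} \<subseteq> dtrees n"
      using code_in_dtrees by auto
    show "dtrees n \<subseteq> code ` {c. is_cell c \<and> arity c = n}"
    proof
      fix t assume "t \<in> dtrees n"
      then have "name t \<in> names n t" by (rule name_in_names)
      then have "name t \<in> {c. is_cell c \<and> arity c = n}" "t = code (name t)"
        by (auto simp: names_def)
      then show "t \<in> code ` {c. is_cell c \<and> arity c = n}"
        by (rule rev_image_eqI)
    qed
  qed
  finally show ?thesis .
qed

lemma composihedron_iff:
  assumes "s \<in> dtrees n" "t \<in> dtrees n"
  shows "(names n s, names n t) \<in> composihedron n \<longleftrightarrow> dle s t"
proof -
  have "(\<exists>c \<in> names n s. \<exists>d \<in> names n t. cell_le c d) \<longleftrightarrow> dle s t"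
    using name_in_names[OF assms(1)] name_in_names[OF assms(2)] cell_le_iff
    by (auto simp: names_def)
  then show ?thesis
    using assms by (simp add: composihedron_def compo_cells_eq)
qed

lemma Field_composihedron: "Field (composihedron n) = names n ` dtrees n"
proof
  show "Field (composihedron n) \<subseteq> names n ` dtrees n"
    by (auto simp: Field_def composihedron_def compo_cells_eq)
  show "names n ` dtrees n \<subseteq> Field (composihedron n)"
    using composihedron_iff by (blast intro: FieldI1)
qed

text \<open>All names of a cell have the dimension of its tree, so choosing one name in
  \<open>compo_cells_dim\<close> does no harm.\<close>

lemma compo_cells_dim_eq: "compo_cells_dim n d = names n ` {t \<in> dtrees n. ddim t = d}"
proof -
  have "(\<exists>c \<in> names n t. cell_dim c = d) \<longleftrightarrow> ddim t = d" if "t \<in> dtrees n" for t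
  proof -
    have "\<forall>c \<in> names n t. cell_dim c = ddim t"
      using ddim_code by (auto simp: names_def)
    with name_in_names[OF that] show ?thesis by auto
  qed
  then show ?thesis
    by (auto simp: compo_cells_dim_def compo_cells_eq)
qed

lemma card_compo_cells_dim: "card (compo_cells_dim n d) = card {t \<in> dtrees n. ddim t = d}"
  unfolding compo_cells_dim_eq by (intro card_image inj_on_subset[OF inj_names]) auto

lemma Field_associahedron: "Field (associahedron n) = assoc_faces n"
proof
  show "Field (associahedron n) \<subseteq> assoc_faces n"
    by (auto simp: Field_def associahedron_def)
  show "assoc_faces n \<subseteq> Field (associahedron n)"
    by (auto simp: associahedron_def intro!: FieldI1)
qed

lemma collapse1_unpainted: "collapse1 s t \<Longrightarrow> unpainted s \<Longrightarrow> unpainted t"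
  by (induction rule: collapse1.induct) auto

text \<open>\<open>T\<close> is the graph of the bijection. Both orders are reflexive transitive
  closures of single steps, and no step leaves the set of faces, so it is enough to compare single
  steps.\<close>

lemma combinatorially_equivalentI:
  assumes fst: "fst ` T = dtrees n" and snd: "snd ` T = assoc_faces m"
    and inj: "inj_on fst T" "inj_on snd T"
    and steps: "\<And>s u t v. (s, u) \<in> T \<Longrightarrow> (t, v) \<in> T \<Longrightarrow> dstep s t \<longleftrightarrow> collapse1 u v"
  shows "combinatorially_equivalent (composihedron n) (associahedron m)"
proof -
  define g where "g X = snd (inv_into T (names n \<circ> fst) X)" for X
  have inj_nf: "inj_on (names n \<circ> fst) T"
    using inj(1) fst inj_names by (intro comp_inj_on) auto
  have g: "g (names n s) = u" if "(s, u) \<in> T" for s u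
    using inv_into_f_f[OF inj_nf that] by (simp add: g_def)
  have field: "Field (composihedron n) = (names n \<circ> fst) ` T"
    by (simp add: Field_composihedron image_comp flip: fst)
  have "g ` (names n \<circ> fst) ` T = snd ` T"
    unfolding image_image by (intro image_cong) (auto simp: g)
  moreover have "inj_on g ((names n \<circ> fst) ` T)"
  proof (rule inj_onI)
    fix X Y assume "X \<in> (names n \<circ> fst) ` T" "Y \<in> (names n \<circ> fst) ` T" and eq: "g X = g Y"
    then obtain s u t v where T: "(s, u) \<in> T" "(t, v) \<in> T" and XY: "X = names n s" "Y = names n t"
      by fastforce
    with eq have "u = v" by (simp add: g)
    with inj_onD[OF inj(2) _ T] XY show "X = Y" by simp
  qed
  ultimately have "bij_betw g (Field (composihedron n)) (Field (associahedron m))"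
    by (simp add: bij_betw_def field Field_associahedron snd)
  moreover have dle_iff: "dle s t \<longleftrightarrow> refines u v" if su: "(s, u) \<in> T" and tv: "(t, v) \<in> T" for s u t v
  proof
    \<comment> \<open>A chain of steps from \<open>s\<close> is followed along \<open>T\<close>:
      each next tree is again proper of size \<open>n\<close>, hence has a partner.\<close>
    have "\<exists>v. (t, v) \<in> T \<and> refines u v" if "dle s t" for t
      using that
    proof (induction rule: rtranclp_induct)
      case base
      then show ?case using su by auto
    next
      case (step t t')
      then obtain v where v: "(t, v) \<in> T" "refines u v" by blast
      from v(1) fst have "t \<in> dtrees n" by force
      then have "t' \<in> dtrees n"
        using dstep_proper[OF step.hyps(2)] dstep_dsize[OF step.hyps(2)] by (simp add: dtrees_def)
      then obtain v' where "(t', v') \<in> T" using fst by force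
      moreover from this have "refines v v'"
        using steps[OF v(1)] step.hyps(2) by (simp add: collapse1_refines)
      ultimately show ?case
        using refines_trans[OF v(2)] by blast
    qed
    moreover assume "dle s t"
    ultimately show "refines u v"
      using tv inj(1) by (metis fst_conv inj_onD snd_conv)
  next
    have "\<exists>t. (t, v) \<in> T \<and> dle s t" if "refines u v" for v
      using that[unfolded refines_def]
    proof (induction rule: rtranclp_induct)
      case base
      then show ?case using su by auto
    next
      case (step v v')
      then obtain t where t: "(t, v) \<in> T" "dle s t" by blast
      from t(1) snd have "v \<in> assoc_faces m" by force
      then have "v' \<in> assoc_faces m"
        using collapse1_unpainted[OF step.hyps(2)] collapse1_leaves[OF step.hyps(2)]
        by (simp add: assoc_faces_def)
      then obtain t' where "(t', v') \<in> T" using snd by force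
      moreover from this have "dstep t t'"
        using steps[OF t(1)] step.hyps(2) by simp
      ultimately show ?case
        using rtranclp.rtrancl_into_rtrancl[OF t(2)] by blast
    qed
    moreover assume "refines u v"
    ultimately show "dle s t"
      using tv inj(2) by (metis fst_conv inj_onD snd_conv)
  qed
  have "(X, Y) \<in> composihedron n \<longleftrightarrow> (g X, g Y) \<in> associahedron m"
    if X: "X \<in> Field (composihedron n)" and Y: "Y \<in> Field (composihedron n)" for X Y
  proof -
    obtain s u t v where T: "(s, u) \<in> T" "(t, v) \<in> T" and XY: "X = names n s" "Y = names n t"
      using X Y unfolding field by fastforce
    moreover have "s \<in> dtrees n" "t \<in> dtrees n" "u \<in> assoc_faces m" "v \<in> assoc_faces m"
      using T fst snd by force+
    ultimately show ?thesis
      using dle_iff by (simp add: g composihedron_iff associahedron_def)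
  qed
  ultimately show ?thesis
    unfolding combinatorially_equivalent_def by blast
qed

lemma not_combinatorially_equivalentI:
  assumes "card (dtrees n) \<noteq> card (assoc_faces m)"
  shows "\<not> combinatorially_equivalent (composihedron n) (associahedron m)"
proof
  assume "combinatorially_equivalent (composihedron n) (associahedron m)"
  then have "card (names n ` dtrees n) = card (assoc_faces m)"
    using bij_betw_same_card
    unfolding combinatorially_equivalent_def Field_composihedron Field_associahedron by blast
  with assms show False by (simp add: card_image inj_names)
qed


section \<open>Enumeration of trees\<close>

fun sizes :: "nat \<Rightarrow> nat list" where
  "sizes 0 = []"
| "sizes (Suc n) = sizes n @ [Suc n]"

lemma in_set_sizes [simp]: "k \<in> set (sizes n) \<longleftrightarrow> 1 \<le> k \<and> k \<le> n"
  by (induction n) auto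

text \<open>\<open>T k\<close> lists the items of size \<open>k\<close>; \<open>seqs T n\<close> lists the sequences of items of total
  size \<open>n\<close>, and \<open>multi T n\<close> those with at least two items.  Everything is defined by
  pattern matching, so that unfolding stops at bound variables.\<close>

function seqs :: "(nat \<Rightarrow> 'a list) \<Rightarrow> nat \<Rightarrow> 'a list list" where
  "seqs T 0 = [[]]"
| "seqs T (Suc n) =
    concat (map (\<lambda>k. concat (map (\<lambda>t. map ((#) t) (seqs T (Suc n - k))) (T k))) (sizes (Suc n)))"
  by pat_completeness auto
termination by (relation "measure snd") (auto simp del: sizes.simps)

definition multi :: "(nat \<Rightarrow> 'a list) \<Rightarrow> nat \<Rightarrow> 'a list list" where
  "multi T n =
    concat (map (\<lambda>k. concat (map (\<lambda>t. map ((#) t) (seqs T (n - k))) (T k))) (sizes (n - 1)))"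

lemma in_seqs_Suc:
  "us \<in> set (seqs T (Suc n)) \<longleftrightarrow> (\<exists>k t ts. 1 \<le> k \<and> k \<le> Suc n \<and> t \<in> set (T k) \<and>
    ts \<in> set (seqs T (Suc n - k)) \<and> us = t # ts)"
  unfolding seqs.simps(2) set_concat set_map UN_iff bex_simps image_iff
  unfolding Bex_def in_set_sizes by blast

lemma in_multi:
  "us \<in> set (multi T n) \<longleftrightarrow> (\<exists>k t ts. 1 \<le> k \<and> k < n \<and> t \<in> set (T k) \<and>
    ts \<in> set (seqs T (n - k)) \<and> us = t # ts)"
proof -
  have sizes: "k \<in> set (sizes (n - 1)) \<longleftrightarrow> 1 \<le> k \<and> k < n" for k by auto
  show ?thesis
    unfolding multi_def set_concat set_map UN_iff bex_simps image_iff
    unfolding Bex_def sizes by blast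
qed

lemma seqs_cong: "(\<And>k. 1 \<le> k \<Longrightarrow> k \<le> n \<Longrightarrow> T k = T' k) \<Longrightarrow> seqs T n = seqs T' n"
proof (induction n rule: less_induct)
  case (less n)
  show ?case
  proof (cases n)
    case (Suc m)
    have "seqs T (Suc m - k) = seqs T' (Suc m - k)" if "k \<in> set (sizes (Suc m))" for k
      using that less.prems Suc by (intro less.IH) (auto simp del: sizes.simps)
    moreover have "T k = T' k" if "k \<in> set (sizes (Suc m))" for k
      using that less.prems Suc by (simp del: sizes.simps)
    ultimately show ?thesis
      unfolding Suc seqs.simps by (intro arg_cong[where f = concat] map_cong refl) simp
  qed simp
qed

text \<open>With at least two items each has size below n, so \<open>T\<close> is consulted below n
  only. This justifies the recursive definitions of \<open>utree_list\<close> and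
  \<open>dtree_list\<close>.\<close>

lemma multi_cong [fundef_cong]:
  assumes "n = n'" "\<And>k. 1 \<le> k \<Longrightarrow> k < n' \<Longrightarrow> T k = T' k"
  shows "multi T n = multi T' n'"
proof -
  have "seqs T (n' - k) = seqs T' (n' - k)" if "k \<in> set (sizes (n' - 1))" for k
    using that assms(2) by (intro seqs_cong) auto
  moreover have "T k = T' k" if "k \<in> set (sizes (n' - 1))" for k
    using that assms(2) by auto
  ultimately show ?thesis
    unfolding multi_def assms(1) by (intro arg_cong[where f = concat] map_cong refl) simp
qed

lemma set_seqs:
  assumes "\<And>t. Q t \<Longrightarrow> 1 \<le> sz t"
    and "\<And>k. 1 \<le> k \<Longrightarrow> k \<le> n \<Longrightarrow> set (T k) = {t. Q t \<and> sz t = k}"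
  shows "us \<in> set (seqs T n) \<longleftrightarrow> (\<forall>t \<in> set us. Q t) \<and> sum_list (map sz us) = n"
  using assms(2)
proof (induction us arbitrary: n)
  case Nil
  then show ?case by (cases n) (auto simp: in_seqs_Suc simp del: seqs.simps(2))
next
  case (Cons u us)
  show ?case
  proof (cases n)
    case 0
    then show ?thesis using assms(1)[of u] by auto
  next
    case (Suc m)
    have "u # us \<in> set (seqs T n) \<longleftrightarrow>
      (\<exists>k. 1 \<le> k \<and> k \<le> n \<and> u \<in> set (T k) \<and> us \<in> set (seqs T (n - k)))"
      unfolding Suc in_seqs_Suc by auto
    also have "\<dots> \<longleftrightarrow>
      (\<exists>k. 1 \<le> k \<and> k \<le> n \<and> Q u \<and> sz u = k \<and> (\<forall>t \<in> set us. Q t) \<and> sum_list (map sz us) = n - k)"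
      using Cons.prems Cons.IH by (simp cong: conj_cong)
    also have "\<dots> \<longleftrightarrow> (\<forall>t \<in> set (u # us). Q t) \<and> sum_list (map sz (u # us)) = n"
      using assms(1)[of u] by auto
    finally show ?thesis .
  qed
qed

text \<open>A first item smaller than n leaves a positive remainder and so forces a second item;
  conversely a second item, being of positive size, keeps the first below n.\<close>

lemma set_multi:
  assumes "\<And>t. Q t \<Longrightarrow> 1 \<le> sz t"
    and "\<And>k. 1 \<le> k \<Longrightarrow> k < n \<Longrightarrow> set (T k) = {t. Q t \<and> sz t = k}"
  shows "us \<in> set (multi T n) \<longleftrightarrow>
    2 \<le> length us \<and> (\<forall>t \<in> set us. Q t) \<and> sum_list (map sz us) = n"
proof -
  have seqs: "ts \<in> set (seqs T (n - k)) \<longleftrightarrow> (\<forall>t \<in> set ts. Q t) \<and> sum_list (map sz ts) = n - k"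
    if "1 \<le> k" "k < n" for k ts
    using that assms by (intro set_seqs) auto
  show ?thesis
  proof
    assume "us \<in> set (multi T n)"
    then obtain k t ts where k: "1 \<le> k" "k < n" and t: "t \<in> set (T k)" and
      ts: "ts \<in> set (seqs T (n - k))" and us: "us = t # ts"
      unfolding in_multi by blast
    then show "2 \<le> length us \<and> (\<forall>t \<in> set us. Q t) \<and> sum_list (map sz us) = n"
      using assms(2)[OF k] seqs[OF k, of ts] by (cases ts) auto
  next
    assume us: "2 \<le> length us \<and> (\<forall>t \<in> set us. Q t) \<and> sum_list (map sz us) = n"
    then obtain t t' ts where eq: "us = t # t' # ts"
      by (cases us; cases "tl us") auto
    have k: "1 \<le> sz t" "sz t < n"
      using us eq assms(1)[of t] assms(1)[of t'] by auto
    moreover have "t \<in> set (T (sz t))" "t' # ts \<in> set (seqs T (n - sz t))"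
      using us eq assms(2)[OF k] seqs[OF k, of "t' # ts"] by auto
    ultimately show "us \<in> set (multi T n)"
      unfolding in_multi eq by blast
  qed
qed

fun utree_list :: "nat \<Rightarrow> utree list" where
  "utree_list 0 = []"
| "utree_list (Suc 0) = [Leaf]"
| "utree_list (Suc (Suc n)) = map UNode (multi utree_list (Suc (Suc n)))"

text \<open>With the number k as the only item of size k, \<open>seqs\<close> lists the compositions
  of a number, which are the possible label lists of a block.\<close>

fun dtree_list :: "nat \<Rightarrow> dtree list" where
  "dtree_list 0 = []"
| "dtree_list (Suc n) =
     map Block (seqs (\<lambda>k. [k]) (Suc n)) @ map Branch (multi dtree_list (Suc n))"

lemma set_utree_list: "set (utree_list n) = assoc_faces n"
proof (induction n rule: less_induct)
  case (less n)
  have multi: "us \<in> set (multi utree_list n) \<longleftrightarrow>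
    2 \<le> length us \<and> (\<forall>t \<in> set us. unpainted t) \<and> sum_list (map leaves us) = n" for us
    using less by (intro set_multi leaves_pos) (simp_all add: assoc_faces_def)
  have node: "UNode us \<in> assoc_faces n \<longleftrightarrow> us \<in> set (multi utree_list n)" for us
    by (auto simp: multi assoc_faces_def)
  have large: "2 \<le> n" if "UNode us \<in> assoc_faces n" for us
    using that leaves_ge_length[of us] by (auto simp: assoc_faces_def)
  have leaf: "Leaf \<in> assoc_faces n \<longleftrightarrow> n = 1"
    by (auto simp: assoc_faces_def)
  show ?case
  proof (cases n rule: utree_list.cases)
    case (3 m)
    have "u \<in> assoc_faces n \<longleftrightarrow> u \<in> UNode ` set (multi utree_list n)" for u
      using 3 node leaf by (cases u) auto
    with 3 show ?thesis by auto
  next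
    case 1
    have "u \<notin> assoc_faces n" for u
      using 1 large leaf by (cases u) auto
    with 1 show ?thesis by auto
  next
    case 2
    have "u \<in> assoc_faces n \<longleftrightarrow> u = Leaf" for u
      using 2 large leaf by (cases u) auto
    with 2 show ?thesis by auto
  qed
qed

lemma set_dtree_list: "set (dtree_list n) = dtrees n"
proof (induction n rule: less_induct)
  case (less n)
  have multi: "us \<in> set (multi dtree_list n) \<longleftrightarrow>
    2 \<le> length us \<and> (\<forall>t \<in> set us. proper t) \<and> sum_list (map dsize us) = n" for us
    using less by (intro set_multi dsize_pos) (simp_all add: dtrees_def)
  have "ns \<in> set (seqs (\<lambda>k. [k]) n) \<longleftrightarrow>
    (\<forall>n \<in> set ns. 1 \<le> n) \<and> sum_list (map (\<lambda>n. n) ns) = n" for ns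
    by (rule set_seqs) auto
  then have seqs: "ns \<in> set (seqs (\<lambda>k. [k]) n) \<longleftrightarrow> (\<forall>n \<in> set ns. 1 \<le> n) \<and> sum_list ns = n" for ns
    by simp
  have branch: "Branch ts \<in> dtrees n \<longleftrightarrow> ts \<in> set (multi dtree_list n)" for ts
    by (auto simp: multi dtrees_def)
  have block: "Block ns \<in> dtrees n \<longleftrightarrow> ns \<in> set (seqs (\<lambda>k. [k]) n)" if "1 \<le> n" for ns
    using that by (auto simp: seqs dtrees_def)
  show ?case
  proof (cases n)
    case 0
    have "t \<notin> dtrees 0" for t
      using dsize_pos[of t] by (auto simp: dtrees_def)
    with 0 show ?thesis by auto
  next
    case (Suc m)
    have "t \<in> dtrees n \<longleftrightarrow>
      t \<in> Block ` set (seqs (\<lambda>k. [k]) n) \<union> Branch ` set (multi dtree_list n)" for t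
      using block branch Suc by (cases t) (simp_all add: image_iff del: seqs.simps)
    with Suc show ?thesis by (simp del: seqs.simps) blast
  qed
qed

section \<open>Executable single steps\<close>

fun replacements :: "('a \<Rightarrow> 'a list list) \<Rightarrow> 'a list \<Rightarrow> 'a list list" where
  "replacements F [] = []"
| "replacements F (x # xs) = map (\<lambda>ys. ys @ xs) (F x) @ map ((#) x) (replacements F xs)"

lemma replacements_cong [fundef_cong]:
  assumes "xs = xs'" "\<And>x. x \<in> set xs' \<Longrightarrow> F x = F' x"
  shows "replacements F xs = replacements F' xs'"
  using assms(2) unfolding assms(1) by (induction xs') auto

lemma in_set_replacements:
  "ys \<in> set (replacements F xs) \<longleftrightarrow>
    (\<exists>as x bs us. xs = as @ x # bs \<and> us \<in> set (F x) \<and> ys = as @ us @ bs)"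
proof
  show "ys \<in> set (replacements F xs) \<Longrightarrow>
    \<exists>as x bs us. xs = as @ x # bs \<and> us \<in> set (F x) \<and> ys = as @ us @ bs"
  proof (induction xs arbitrary: ys)
    case (Cons x xs)
    then consider us where "us \<in> set (F x)" "ys = us @ xs" |
      zs where "zs \<in> set (replacements F xs)" "ys = x # zs"
      by auto
    then show ?case
    proof cases
      case 1
      then have "x # xs = [] @ x # xs \<and> us \<in> set (F x) \<and> ys = [] @ us @ xs" by simp
      then show ?thesis by blast
    next
      case 2
      then obtain as y bs us where "xs = as @ y # bs" "us \<in> set (F y)" "zs = as @ us @ bs"
        using Cons.IH by blast
      with 2 have "x # xs = (x # as) @ y # bs \<and> us \<in> set (F y) \<and> ys = (x # as) @ us @ bs" by simp
      then show ?thesis by blast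
    qed
  qed simp
  have "as @ us @ bs \<in> set (replacements F (as @ x # bs))" if "us \<in> set (F x)" for as x bs us
    using that by (induction as) auto
  then show "\<exists>as x bs us. xs = as @ x # bs \<and> us \<in> set (F x) \<and> ys = as @ us @ bs \<Longrightarrow>
    ys \<in> set (replacements F xs)"
    by blast
qed

text \<open>A child is replaced by a list, so that one scheme covers both rules: its own children
  are spliced in when the edge below it collapses, a single tree when the collapse happens further
  up.\<close>

fun collapses :: "utree \<Rightarrow> utree list" where
  "collapses Leaf = []"
| "collapses (UNode ts) = map UNode (replacements
     (\<lambda>t. (case t of Leaf \<Rightarrow> [] | UNode us \<Rightarrow> [us]) @ map (\<lambda>u. [u]) (collapses t)) ts)"

fun dsteps :: "dtree \<Rightarrow> dtree list" where
  "dsteps (Block ns) = map Block (replacements (\<lambda>n. map (\<lambda>a. [a, n - a]) (sizes (n - 1))) ns)"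
| "dsteps (Branch ts) =
     (if list_all is_Block ts then [Block (concat (map labels ts))] else []) @
     map Branch (replacements
       (\<lambda>t. (case t of Block ns \<Rightarrow> [] | Branch us \<Rightarrow> [us]) @ map (\<lambda>u. [u]) (dsteps t)) ts)"

lemma collapse1_iff: "collapse1 s t \<longleftrightarrow> t \<in> set (collapses s)"
proof
  show "collapse1 s t \<Longrightarrow> t \<in> set (collapses s)"
  proof (induction rule: collapse1.induct)
    case (1 xs ys zs)
    then show ?case by (fastforce simp: in_set_replacements)
  next
    case (2 s t xs zs)
    then show ?case by (fastforce simp: in_set_replacements)
  qed
next
  show "t \<in> set (collapses s) \<Longrightarrow> collapse1 s t"
  proof (induction s arbitrary: t)
    case (UNode ts)
    then obtain r where "t = UNode r" "r \<in> set (replacements (\<lambda>t.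
      (case t of Leaf \<Rightarrow> [] | UNode us \<Rightarrow> [us]) @ map (\<lambda>u. [u]) (collapses t)) ts)"
      by (auto simp del: set_append)
    then obtain as x bs us where t: "t = UNode (as @ us @ bs)" "ts = as @ x # bs" and
      "us \<in> set ((case x of Leaf \<Rightarrow> [] | UNode us \<Rightarrow> [us]) @ map (\<lambda>u. [u]) (collapses x))"
      unfolding in_set_replacements by blast
    then consider "x = UNode us" | u where "us = [u]" "u \<in> set (collapses x)"
      by (auto split: utree.splits)
    then show ?case
    proof cases
      case 1
      with t show ?thesis by (simp add: collapse1.intros)
    next
      case (2 u)
      with t UNode.IH[of x u] show ?thesis by (simp add: collapse1.intros)
    qed
  qed simp
qed

lemma dstep_iff: "dstep s t \<longleftrightarrow> t \<in> set (dsteps s)"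
proof
  show "dstep s t \<Longrightarrow> t \<in> set (dsteps s)"
  proof (induction rule: dstep.induct)
    case (split a b xs zs)
    have "[a, b] \<in> set (map (\<lambda>k. [k, a + b - k]) (sizes (a + b - 1)))"
      using split by (auto intro!: image_eqI[of _ _ a])
    then have "xs @ [a, b] @ zs \<in>
      set (replacements (\<lambda>n. map (\<lambda>k. [k, n - k]) (sizes (n - 1))) (xs @ (a + b) # zs))"
      unfolding in_set_replacements by blast
    then show ?case by simp
  next
    case (absorb nss)
    then show ?case by (simp add: list_all_iff o_def)
  next
    case (merge xs ys zs)
    then show ?case by (fastforce simp: in_set_replacements)
  next
    case (inner s t xs zs)
    then show ?case by (fastforce simp: in_set_replacements)
  qed
next
  show "t \<in> set (dsteps s) \<Longrightarrow> dstep s t"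
  proof (induction s arbitrary: t)
    case (Block ns)
    then obtain as n bs k where "t = Block (as @ k # (n - k) # bs)" "ns = as @ n # bs"
      "1 \<le> k" "k < n"
      by (auto simp: in_set_replacements)
    then show ?case
      using dstep.split[of k "n - k" as bs] by simp
  next
    case (Branch ts)
    then consider "list_all is_Block ts" "t = Block (concat (map labels ts))" |
      r where "t = Branch r" "r \<in> set (replacements (\<lambda>t.
        (case t of Block ns \<Rightarrow> [] | Branch us \<Rightarrow> [us]) @ map (\<lambda>u. [u]) (dsteps t)) ts)"
      by (auto split: if_splits)
    then consider "list_all is_Block ts" "t = Block (concat (map labels ts))" |
      as x bs us where "t = Branch (as @ us @ bs)" "ts = as @ x # bs"
        "us \<in> set ((case x of Block ns \<Rightarrow> [] | Branch us \<Rightarrow> [us]) @ map (\<lambda>u. [u]) (dsteps x))"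
      unfolding in_set_replacements by cases blast+
    then show ?case
    proof cases
      case 1
      then have "map Block (map labels ts) = ts"
        by (auto simp: list_all_iff intro: map_idI)
      with 1 show ?thesis using dstep.absorb[of "map labels ts"] by simp
    next
      case (2 as x bs us)
      then consider "x = Branch us" | u where "us = [u]" "u \<in> set (dsteps x)"
        by (auto split: dtree.splits)
      then show ?thesis
      proof cases
        case 1
        with 2 show ?thesis by (simp add: dstep.merge)
      next
        case (2 u)
        with \<open>t = _\<close> \<open>ts = _\<close> Branch.IH[of x u] show ?thesis by (simp add: dstep.inner)
      qed
    qed
  qed
qed

text \<open>Every premise concerns explicit lists only, so an equivalence can be checked by
  evaluating a table of matched faces.\<close>

lemma combinatorially_equivalent_tableI:
  assumes "set (map fst tab) = set (dtree_list n)" "set (map snd tab) = set (utree_list m)"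
    and "distinct (map fst tab)" "distinct (map snd tab)"
    and "\<forall>(s, u) \<in> set tab. \<forall>(t, v) \<in> set tab. t \<in> set (dsteps s) \<longleftrightarrow> v \<in> set (collapses u)"
  shows "combinatorially_equivalent (composihedron n) (associahedron m)"
proof (rule combinatorially_equivalentI)
  show "fst ` set tab = dtrees n" "snd ` set tab = assoc_faces m"
    using assms(1,2) by (auto simp: set_dtree_list set_utree_list)
  show "inj_on fst (set tab)" "inj_on snd (set tab)"
    using assms(3,4) by (simp_all add: distinct_map)
next
  fix s u t v assume "(s, u) \<in> set tab" "(t, v) \<in> set tab"
  with assms(5) show "dstep s t \<longleftrightarrow> collapse1 u v"
    unfolding dstep_iff collapse1_iff by blast
qed

section \<open>Evaluation for small n\<close>

lemma equivalent_1: "combinatorially_equivalent (composihedron 1) (associahedron 2)"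
  by (rule combinatorially_equivalent_tableI[where tab = "[(Block [1], corolla 2)]"]; code_simp)

text \<open>Both sides are segments: the interior comes first, then the two end points, which could
  be matched in either way.\<close>

lemma equivalent_2: "combinatorially_equivalent (composihedron 2) (associahedron 3)"
  by (rule combinatorially_equivalent_tableI[where tab =
    "[(Block [1, 1], corolla 3),
      (Block [2], UNode [corolla 2, Leaf]),
      (Branch [Block [1], Block [1]], UNode [Leaf, corolla 2])]"]; code_simp)

text \<open>Both sides are pentagons.  After the interior, edges and vertices alternate around the
  boundary, so each entry is incident with its two cyclic neighbours.\<close>

lemma equivalent_3: "combinatorially_equivalent (composihedron 3) (associahedron 4)"
  by (rule combinatorially_equivalent_tableI[where tab =
    "[(Block [1, 1, 1], corolla 4),
      (Block [2, 1], UNode [corolla 2, Leaf, Leaf]),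
      (Block [3], UNode [UNode [corolla 2, Leaf], Leaf]),
      (Block [1, 2], UNode [corolla 3, Leaf]),
      (Branch [Block [1], Block [2]], UNode [UNode [Leaf, corolla 2], Leaf]),
      (Branch [Block [1], Block [1, 1]], UNode [Leaf, corolla 2, Leaf]),
      (Branch [Block [1], Branch [Block [1], Block [1]]], UNode [Leaf, UNode [corolla 2, Leaf]]),
      (Branch [Block [1], Block [1], Block [1]], UNode [Leaf, corolla 3]),
      (Branch [Branch [Block [1], Block [1]], Block [1]], UNode [Leaf, UNode [Leaf, corolla 2]]),
      (Branch [Block [1, 1], Block [1]], UNode [Leaf, Leaf, corolla 2]),
      (Branch [Block [2], Block [1]], UNode [corolla 2, corolla 2])]"]; code_simp)

lemma card_assoc_faces_dim:
  "card (assoc_faces_dim n d) = card (set (filter (\<lambda>t. assoc_dim t = d) (utree_list n)))"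
  by (simp add: assoc_faces_dim_def set_utree_list)

lemma card_compo_cells_dim_list:
  "card (compo_cells_dim n d) = card (set (filter (\<lambda>t. ddim t = d) (dtree_list n)))"
  by (simp add: card_compo_cells_dim set_dtree_list)

lemma card_assoc_facets_5: "card (assoc_facets 5) = 9"
  unfolding assoc_facets_def card_assoc_faces_dim by code_simp

lemma card_assoc_vertices_5: "card (assoc_vertices 5) = 14"
  unfolding assoc_vertices_def card_assoc_faces_dim by code_simp

lemma card_compo_facets_4: "card (compo_facets 4) = 10"
proof -
  have "card (set (filter (\<lambda>t. ddim t = 4 - 2) (dtree_list 4))) = 10" by code_simp
  then show ?thesis by (simp add: compo_facets_def card_compo_cells_dim_list)
qed

lemma card_compo_vertices_4: "card (compo_vertices 4) = 15"
proof -
  have "card (set (filter (\<lambda>t. ddim t = 0) (dtree_list 4))) = 15" by code_simp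
  then show ?thesis by (simp add: compo_vertices_def card_compo_cells_dim_list)
qed

text \<open>From dimension 3 down to 0 these are 1 + 10 + 23 + 15 faces.\<close>

lemma card_dtrees_4: "card (dtrees 4) = 49"
proof -
  have "card (set (dtree_list 4)) = 49" by code_simp
  then show ?thesis by (simp add: set_dtree_list)
qed

text \<open>From dimension 3 down to 0 these are 1 + 9 + 21 + 14 faces.\<close>

lemma card_assoc_faces_5: "card (assoc_faces 5) = 45"
  unfolding set_utree_list[symmetric] by code_simp

theorem mainTheorem2:
  shows "(\<forall>n \<in> {1, 2, 3}. combinatorially_equivalent (composihedron n) (associahedron (n + 1))) \<and>
    card (assoc_facets 5) = 9 \<and> card (assoc_vertices 5) = 14 \<and>
    card (compo_facets 4) = 10 \<and> card (compo_vertices 4) = 15 \<and>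
    \<not> combinatorially_equivalent (composihedron 4) (associahedron 5)"
proof (intro conjI)
  show "\<forall>n \<in> {1, 2, 3}. combinatorially_equivalent (composihedron n) (associahedron (n + 1))"
    using equivalent_1 equivalent_2 equivalent_3 by (simp add: eval_nat_numeral)
  show "\<not> combinatorially_equivalent (composihedron 4) (associahedron 5)"
    by (rule not_combinatorially_equivalentI) (simp add: card_dtrees_4 card_assoc_faces_5)
qed (fact card_assoc_facets_5 card_assoc_vertices_5 card_compo_facets_4 card_compo_vertices_4)+

end
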